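(* Let $(X,T)$ be a topological dynamical system. For any $\mu\in E(X,T)$ and $\varphi\in C(X,\mathbb{R})$, $$h_\mu(T)+\int\varphi\,\mathrm{d}\mu=\lim_{\varepsilon\to0}\liminf_{n\to\infty}\frac1n\log S_n^{FK}(\varphi,\mu,\varepsilon)=\lim_{\varepsilon\to0}\limsup_{n\to\infty}\frac1n\log S_n^{FK}(\varphi,\mu,\varepsilon).$$
   Context: A topological dynamical system is a pair $(X,T)$ where $X$ is a compact metric space with metric $d$ and $T:X\to X$ is a homeomorphism. $C(X,\mathbb{R})$ is the set of continuous real-valued functions on $X$; $E(X,T)$ is the set of ergodic $T$-invariant Borel probability measures on $X$; $h_\mu(T)$ is the (Kolmogorov–Sinai) measure-theoretic entropy. $[n]=\{0,1,\dots,n-1\}$. For $x,y\in X$, $\delta>0$ and integers $n,q\ge1$, a $(q,n,\delta)$-match of $x$ and $y$ is an order-preserving bijection $\pi:D(\pi)\to R(\pi)$ (i.e. $\pi(i)<\pi(j)$ whenever $i<j$) with $D(\pi),R(\pi)\subset[n]$ and $d(T^{qi}x,T^{q\pi(i)}y)<\delta$ for every $i\in D(\pi)$; $|\pi|$ denotes the cardinality of $D(\pi)$. Put $$\mathscr{F}^q_{n,\delta}(x,y)=1-\frac{\max\{|\pi|:\pi\text{ is a }(q,n,\delta)\text{-match of }x\text{ and }y\}}{n},\qquad d_{FK_n^q}(x,y)=\inf\{\delta>0:\mathscr{F}^q_{n,\delta}(x,y)<\delta\},$$ and $B_{d_{FK_n^q}}(x,\varepsilon)=\{y\in X:d_{FK_n^q}(x,y)<\varepsilon\}$.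 Put $S_n^q\varphi(x)=\sum_{i=0}^{n-1}\varphi(T^{qi}x)$. For $\varepsilon>0$, $$S_{d_{FK_n^q}}(\varphi,\mu,\varepsilon)=\inf\Big\{\sum_{i=1}^k e^{S_n^q\varphi(x_i)}:\ \mu\Big(\bigcup_{i=1}^kB_{d_{FK_n^q}}(x_i,\varepsilon)\Big)>1-\varepsilon\Big\},$$ the infimum being over finite collections $x_1,\dots,x_k\in X$, and $$S_n^{FK}(\varphi,\mu,\varepsilon)=\inf_{q\ge1}S_{d_{FK_n^q}}(\varphi,\mu,\varepsilon).$$ *)

theory Defs
  imports "HOL-Probability.Probability"
begin

text \<open>The phase space is the whole type \<^typ>\<open>'a::metric_space\<close>, required to be compact.\<close>

definition top_dyn_system :: "('a::metric_space \<Rightarrow> 'a) \<Rightarrow> bool" where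
  "top_dyn_system T \<longleftrightarrow> compact (UNIV :: 'a set) \<and> (\<exists>S. homeomorphism UNIV UNIV T S)"

definition ergodic_measures :: "('a::metric_space \<Rightarrow> 'a) \<Rightarrow> 'a measure set" where
  "ergodic_measures T =
     {\<mu>. prob_space \<mu> \<and> sets \<mu> = sets borel \<and> distr \<mu> \<mu> T = \<mu> \<and>
          (\<forall>A\<in>sets \<mu>. T -` A \<inter> space \<mu> = A \<longrightarrow> measure \<mu> A = 0 \<or> measure \<mu> A = 1)}"


definition finite_partitions :: "'a measure \<Rightarrow> 'a set set set" where
  "finite_partitions \<mu> = {\<xi>. finite \<xi> \<and> \<xi> \<subseteq> sets \<mu> \<and> partition_on (space \<mu>) \<xi>}"

text \<open>The join of the preimages of \<open>\<xi>\<close> under \<open>T ^^ i\<close> for \<open>i < n\<close>; the cell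
  selected from the \<open>i\<close>-th preimage is the one of \<open>c i\<close>.\<close>

definition iterated_join :: "'a measure \<Rightarrow> ('a \<Rightarrow> 'a) \<Rightarrow> 'a set set \<Rightarrow> nat \<Rightarrow> 'a set set" where
  "iterated_join \<mu> T \<xi> n =
     {{x \<in> space \<mu>. \<forall>i<n. (T ^^ i) x \<in> c i} | c. \<forall>i<n. c i \<in> \<xi>} - {{}}"

text \<open>Since \<open>0 * ln 0 = 0\<close> in HOL, null cells contribute nothing, as usual.\<close>

definition partition_entropy :: "'a measure \<Rightarrow> 'a set set \<Rightarrow> real" where
  "partition_entropy \<mu> \<xi> = - (\<Sum>A\<in>\<xi>. measure \<mu> A * ln (measure \<mu> A))"

definition entropy_wrt_partition :: "'a measure \<Rightarrow> ('a \<Rightarrow> 'a) \<Rightarrow> 'a set set \<Rightarrow> ereal" where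
  "entropy_wrt_partition \<mu> T \<xi> =
     lim (\<lambda>n. ereal (partition_entropy \<mu> (iterated_join \<mu> T \<xi> n) / real n))"

definition ks_entropy :: "'a measure \<Rightarrow> ('a \<Rightarrow> 'a) \<Rightarrow> ereal" where
  "ks_entropy \<mu> T = (SUP \<xi>\<in>finite_partitions \<mu>. entropy_wrt_partition \<mu> T \<xi>)"


text \<open>A match is a function on all of \<^typ>\<open>nat\<close> with explicit domain \<open>D\<close> and range \<open>R\<close>;
  its values outside \<open>D\<close> are irrelevant.\<close>

definition fk_match ::
  "('a::metric_space \<Rightarrow> 'a) \<Rightarrow> nat \<Rightarrow> nat \<Rightarrow> real \<Rightarrow> 'a \<Rightarrow> 'a \<Rightarrow> (nat \<Rightarrow> nat) \<Rightarrow> nat set \<Rightarrow> nat set \<Rightarrow> bool"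
where
  "fk_match T q n \<delta> x y \<pi> D R \<longleftrightarrow>
     D \<subseteq> {..<n} \<and> R \<subseteq> {..<n} \<and> bij_betw \<pi> D R \<and> strict_mono_on D \<pi> \<and>
     (\<forall>i\<in>D. dist ((T ^^ (q * i)) x) ((T ^^ (q * \<pi> i)) y) < \<delta>)"

definition fk_gap :: "('a::metric_space \<Rightarrow> 'a) \<Rightarrow> nat \<Rightarrow> nat \<Rightarrow> real \<Rightarrow> 'a \<Rightarrow> 'a \<Rightarrow> real" where
  "fk_gap T q n \<delta> x y =
     1 - real (Max {card D | \<pi> D R. fk_match T q n \<delta> x y \<pi> D R}) / real n"

definition fk_dist :: "('a::metric_space \<Rightarrow> 'a) \<Rightarrow> nat \<Rightarrow> nat \<Rightarrow> 'a \<Rightarrow> 'a \<Rightarrow> real" where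
  "fk_dist T q n x y = Inf {\<delta>. \<delta> > 0 \<and> fk_gap T q n \<delta> x y < \<delta>}"

definition fk_ball :: "('a::metric_space \<Rightarrow> 'a) \<Rightarrow> nat \<Rightarrow> nat \<Rightarrow> 'a \<Rightarrow> real \<Rightarrow> 'a set" where
  "fk_ball T q n x \<epsilon> = {y. fk_dist T q n x y < \<epsilon>}"

definition birkhoff_sum :: "('a \<Rightarrow> 'a) \<Rightarrow> nat \<Rightarrow> nat \<Rightarrow> ('a \<Rightarrow> real) \<Rightarrow> 'a \<Rightarrow> real" where
  "birkhoff_sum T q n \<phi> x = (\<Sum>i<n. \<phi> ((T ^^ (q * i)) x))"

definition fk_cover_sum ::
  "('a::metric_space \<Rightarrow> 'a) \<Rightarrow> nat \<Rightarrow> nat \<Rightarrow> ('a \<Rightarrow> real) \<Rightarrow> 'a measure \<Rightarrow> real \<Rightarrow> real"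
where
  "fk_cover_sum T q n \<phi> \<mu> \<epsilon> =
     Inf {(\<Sum>i=1..k. exp (birkhoff_sum T q n \<phi> (x i))) | (k::nat) (x :: nat \<Rightarrow> 'a).
            k \<ge> 1 \<and> measure \<mu> (\<Union>i\<in>{1..k}. fk_ball T q n (x i) \<epsilon>) > 1 - \<epsilon>}"

definition fk_cover_sum_inf ::
  "('a::metric_space \<Rightarrow> 'a) \<Rightarrow> nat \<Rightarrow> ('a \<Rightarrow> real) \<Rightarrow> 'a measure \<Rightarrow> real \<Rightarrow> real"
where
  "fk_cover_sum_inf T n \<phi> \<mu> \<epsilon> = (INF q\<in>{1..}. fk_cover_sum T q n \<phi> \<mu> \<epsilon>)"

end

theory Submission
  imports Defs
begin

text \<open>
  Upper bound, with \<open>q = 1\<close>: for a partition of small diameter, points with equal itineraries of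
  length \<open>n\<close> are FK-close, so it suffices to cover most of the space by few itineraries. Weighing words by
  the \<open>m\<close>-step Markov approximation of the measure, whose information function has integral
  \<open>H (m + 1) - H m\<close>, a one-sided ergodic theorem shows that most points have itineraries of weight at
  least \<open>exp (- n (h + \<eta>))\<close>, and there are few of these since the weights sum to a constant.

  Lower bound, for all \<open>q\<close> at once and without ergodicity: by strong subadditivity the entropy of the word read
  along \<open>0, q, \<dots>, (n - 1) q\<close> is at least \<open>n h\<close>. Replacing the cells of a partition by closed subsets at
  positive mutual distance, an FK-ball of small radius contains at most \<open>exp (n \<delta>)\<close> such words with \<open>\<delta>\<close>
  small, once the few points that often visit the complement of these subsets are discarded. The Gibbs inequality, applied to weights that give
  \<open>exp (S \<phi> (x i))\<close> to each word of the \<open>i\<close>-th ball, compares entropy plus integral with the cover sum.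
\<close>

section \<open>Entropy of finite codings\<close>

text \<open>The infimum over \<open>q\<close> stands inside the limit in \<open>n\<close>, so
  \<open>q\<close> may vary with \<open>n\<close>, and powers of \<open>T\<close> need not be
  ergodic; estimates with rates depending on \<open>q\<close> would be of no use for the lower
  bound. It therefore compares integrals only (entropy, mean Birkhoff sum, mean number of visits),
  for which invariance gives bounds uniform in \<open>q\<close>. A bad set of measure
  \<open>\<theta>\<close> then costs a constant times \<open>\<theta> * n\<close>, which is
  affordable after division by \<open>n\<close>. The closed subsets of the cells serve because cells
  may touch, so that nearby orbit points would not determine a symbol. The upper bound needs only
  one-sided estimates, of the information and of the Birkhoff sums, so a maximal inequality takes
  the place of the Birkhoff and Shannon-McMillan-Breiman theorems; the finite memory
  \<open>m\<close> keeps the information function bounded.\<close>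

lemma gibbs_inequality:
  fixes p a :: "'w \<Rightarrow> real"
  assumes "finite A" and p0: "\<And>w. w \<in> A \<Longrightarrow> p w \<ge> 0" and p1: "sum p A = 1"
    and a0: "\<And>w. w \<in> A \<Longrightarrow> a w \<ge> 0" and ap: "\<And>w. w \<in> A \<Longrightarrow> p w > 0 \<Longrightarrow> a w > 0"
    and Z: "sum a A \<le> Z" "Z > 0"
  shows "(\<Sum>w\<in>A. p w * ln (a w)) - (\<Sum>w\<in>A. p w * ln (p w)) \<le> ln Z"
proof -
  have "p w * ln (a w) - p w * ln (p w) - p w * ln Z \<le> a w / Z - p w" if "w \<in> A" for w
  proof (cases "p w = 0")
    case True
    then show ?thesis using a0[OF that] Z by simp
  next
    case False
    then have p: "p w > 0" and a: "a w > 0" using p0[OF that] ap[OF that] by auto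
    have "ln (a w / (p w * Z)) \<le> a w / (p w * Z) - 1"
      using p a Z by (intro ln_le_minus_one) simp
    then have "p w * ln (a w / (p w * Z)) \<le> p w * (a w / (p w * Z) - 1)"
      using p by (intro mult_left_mono) auto
    also have "\<dots> = a w / Z - p w" using p Z by (simp add: field_simps)
    also have "ln (a w / (p w * Z)) = ln (a w) - ln (p w) - ln Z"
      using p a Z by (simp add: ln_div ln_mult)
    finally show ?thesis by (simp add: algebra_simps)
  qed
  then have "(\<Sum>w\<in>A. p w * ln (a w) - p w * ln (p w) - p w * ln Z) \<le> (\<Sum>w\<in>A. a w / Z - p w)"
    by (rule sum_mono)
  also have "\<dots> = sum a A / Z - 1"
    by (simp add: sum_subtractf p1 sum_divide_distrib)
  also have "\<dots> \<le> 0" using Z by simp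
  finally show ?thesis
    using p1 by (simp add: sum_subtractf sum_distrib_right[symmetric])
qed

text \<open>\<^term>\<open>F i x\<close> is the symbol of \<^term>\<open>x\<close> at index \<^term>\<open>i\<close>; the entropy of the join over \<^term>\<open>I\<close>
  is defined as the integral of the information function, which makes reindexing and invariance immediate.\<close>

definition cyl_prob :: "'a measure \<Rightarrow> ('i \<Rightarrow> 'a \<Rightarrow> 'b) \<Rightarrow> 'i set \<Rightarrow> ('i \<Rightarrow> 'b) \<Rightarrow> real" where
  "cyl_prob M F I w = measure M {x \<in> space M. \<forall>i\<in>I. F i x = w i}"

definition cyl_entropy :: "'a measure \<Rightarrow> ('i \<Rightarrow> 'a \<Rightarrow> 'b) \<Rightarrow> 'i set \<Rightarrow> real" where
  "cyl_entropy M F I = - (\<integral>x. ln (cyl_prob M F I (\<lambda>i. F i x)) \<partial>M)"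

lemma cyl_prob_cong: "(\<And>i. i \<in> I \<Longrightarrow> v i = w i) \<Longrightarrow> cyl_prob M F I v = cyl_prob M F I w"
  unfolding cyl_prob_def by (intro arg_cong[where f = "measure M"]) auto

lemma cyl_prob_restrict [simp]: "cyl_prob M F I (restrict w I) = cyl_prob M F I w"
  by (rule cyl_prob_cong) simp

lemma cyl_prob_nonneg [simp]: "cyl_prob M F I w \<ge> 0"
  by (simp add: cyl_prob_def)

lemma cyl_entropy_reindex: "cyl_entropy M (\<lambda>i. F (g i)) I = cyl_entropy M F (g ` I)"
  by (simp add: cyl_entropy_def cyl_prob_def)

locale finite_coding = prob_space M for M :: "'a measure" +
  fixes F :: "'i \<Rightarrow> 'a \<Rightarrow> 'b" and S :: "'b set"
  assumes finite_S: "finite S" and coding_measurable: "\<And>i. F i \<in> measurable M (count_space S)"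
begin

lemma coding_in_S: "x \<in> space M \<Longrightarrow> F i x \<in> S"
  using measurable_space[OF coding_measurable] by simp

lemma cylinder_sets [measurable]:
  assumes "finite I"
  shows "{x \<in> space M. \<forall>i\<in>I. F i x = w i} \<in> sets M"
proof -
  have "{x \<in> space M. F i x = w i} \<in> sets M" for i
  proof -
    have "{x \<in> space M. F i x = w i} = F i -` ({w i} \<inter> S) \<inter> space M"
      using coding_in_S by auto
    also have "\<dots> \<in> sets M" using coding_measurable by (rule measurable_sets) simp
    finally show ?thesis .
  qed
  then show ?thesis using assms by (intro sets.sets_Collect_finite_All) auto
qed

text \<open>A function of the word is constant on cylinders, hence simple. This converts between
  integrals over \<open>M\<close>, from which invariance is read off, and sums over words, to which
  the Gibbs inequality applies.\<close>

lemma integral_word: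
  fixes g :: "('i \<Rightarrow> 'b) \<Rightarrow> real"
  assumes I: "finite I"
  shows "integrable M (\<lambda>x. g (\<lambda>i\<in>I. F i x))"
    and "(\<integral>x. g (\<lambda>i\<in>I. F i x) \<partial>M) = (\<Sum>w\<in>PiE I (\<lambda>_. S). cyl_prob M F I w * g w)"
proof -
  let ?W = "PiE I (\<lambda>_. S)" and ?C = "\<lambda>w. {x \<in> space M. \<forall>i\<in>I. F i x = w i}"
  have fin: "finite ?W" using I finite_S by (intro finite_PiE) auto
  have eq: "g (\<lambda>i\<in>I. F i x) = (\<Sum>w\<in>?W. g w * indicator (?C w) x)" if x: "x \<in> space M" for x
  proof -
    have "(\<Sum>w\<in>?W. g w * indicator (?C w) x) = (\<Sum>w\<in>?W. if w = (\<lambda>i\<in>I. F i x) then g w else 0)"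
      using x by (intro sum.cong) (auto simp: indicator_def PiE_eq_iff intro!: PiE_ext)
    also have "\<dots> = g (\<lambda>i\<in>I. F i x)"
      using fin coding_in_S[OF x] by (simp add: sum.delta')
    finally show ?thesis by simp
  qed
  have int: "integrable M (\<lambda>x. \<Sum>w\<in>?W. g w * indicator (?C w) x)"
    using I by (intro Bochner_Integration.integrable_sum integrable_mult_right) (auto simp: less_top[symmetric])
  show "integrable M (\<lambda>x. g (\<lambda>i\<in>I. F i x))"
    using int by (subst Bochner_Integration.integrable_cong[OF refl eq]) auto
  have "(\<integral>x. g (\<lambda>i\<in>I. F i x) \<partial>M) = (\<integral>x. (\<Sum>w\<in>?W. g w * indicator (?C w) x) \<partial>M)"
    by (intro Bochner_Integration.integral_cong eq refl)
  also have "\<dots> = (\<Sum>w\<in>?W. g w * measure M (?C w))"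
    using I by (subst Bochner_Integration.integral_sum)
      (auto intro!: integrable_mult_right sum.cong simp: less_top[symmetric] Int_absorb2)
  finally show "(\<integral>x. g (\<lambda>i\<in>I. F i x) \<partial>M) = (\<Sum>w\<in>?W. cyl_prob M F I w * g w)"
    by (simp add: cyl_prob_def mult.commute)
qed

lemma sum_cyl_prob: "finite I \<Longrightarrow> (\<Sum>w\<in>PiE I (\<lambda>_. S). cyl_prob M F I w) = 1"
  using integral_word(2)[of I "\<lambda>_. 1"] by (simp add: prob_space)

text \<open>Expressing the entropies of all subsets of \<open>J\<close> as sums over the same words
  on \<open>J\<close> lets several of them enter one Gibbs inequality.\<close>

lemma integral_ln_cyl_prob:
  assumes "finite J" "I \<subseteq> J"
  shows "integrable M (\<lambda>x. ln (cyl_prob M F I (\<lambda>i. F i x)))"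
    and "cyl_entropy M F I = - (\<Sum>w\<in>PiE J (\<lambda>_. S). cyl_prob M F J w * ln (cyl_prob M F I w))"
proof -
  have eq: "cyl_prob M F I (\<lambda>i. F i x) = cyl_prob M F I (\<lambda>i\<in>J. F i x)" for x
    using assms by (intro cyl_prob_cong) auto
  show "integrable M (\<lambda>x. ln (cyl_prob M F I (\<lambda>i. F i x)))"
    "cyl_entropy M F I = - (\<Sum>w\<in>PiE J (\<lambda>_. S). cyl_prob M F J w * ln (cyl_prob M F I w))"
    unfolding cyl_entropy_def eq
    using integral_word[OF assms(1), of "\<lambda>w. ln (cyl_prob M F I w)"] by simp_all
qed

lemma cyl_prob_antimono:
  assumes "finite I" "K \<subseteq> I"
  shows "cyl_prob M F I w \<le> cyl_prob M F K w"
  unfolding cyl_prob_def using assms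
  by (intro finite_measure_mono cylinder_sets) (auto intro: finite_subset)

lemma sum_cyl_prob_insert:
  assumes I: "finite I" "a \<notin> I"
  shows "(\<Sum>s\<in>S. cyl_prob M F (insert a I) (w(a := s))) = cyl_prob M F I w"
proof -
  let ?B = "\<lambda>s. {x \<in> space M. \<forall>i\<in>insert a I. F i x = (w(a := s)) i}"
  have "prob (\<Union>s\<in>S. ?B s) = (\<Sum>s\<in>S. prob (?B s))"
  proof (intro finite_measure_finite_Union finite_S)
    show "?B ` S \<subseteq> sets M" using I by (intro image_subsetI cylinder_sets) simp
    show "disjoint_family_on ?B S" by (auto simp: disjoint_family_on_def)
  qed
  moreover have "(\<Union>s\<in>S. ?B s) = {x \<in> space M. \<forall>i\<in>I. F i x = w i}"
    using coding_in_S I by auto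
  ultimately show ?thesis by (simp add: cyl_prob_def)
qed

text \<open>The conditional probabilities of the next symbol sum to 1 if the cylinder of
  \<open>w\<close> has positive measure, and to 0 otherwise since division by 0 gives 0.\<close>

lemma sum_cyl_prob_ratio_le_1:
  assumes "finite I" "a \<notin> I"
  shows "(\<Sum>s\<in>S. cyl_prob M F (insert a I) (w(a := s)) / cyl_prob M F I w) \<le> 1"
  using sum_cyl_prob_insert[OF assms, of w] by (simp add: sum_divide_distrib[symmetric])

lemma sum_PiE_insert:
  fixes g :: "('i \<Rightarrow> 'b) \<Rightarrow> real"
  assumes "a \<notin> I" "finite I"
  shows "(\<Sum>w\<in>PiE (insert a I) (\<lambda>_. S). g w) = (\<Sum>w\<in>PiE I (\<lambda>_. S). \<Sum>s\<in>S. g (w(a := s)))"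
proof -
  have inj: "inj_on (\<lambda>(s, w). w(a := s)) (S \<times> PiE I (\<lambda>_. S))"
    using inj_combinator[OF assms(1), of "\<lambda>_. S"] by simp
  have "(\<Sum>w\<in>PiE (insert a I) (\<lambda>_. S). g w) = (\<Sum>(s, w)\<in>S \<times> PiE I (\<lambda>_. S). g (w(a := s)))"
    unfolding PiE_insert_eq by (subst sum.reindex[OF inj]) (auto intro!: sum.cong)
  also have "\<dots> = (\<Sum>s\<in>S. \<Sum>w\<in>PiE I (\<lambda>_. S). g (w(a := s)))"
    using finite_S assms by (subst sum.cartesian_product) auto
  finally show ?thesis by (subst sum.swap)
qed

lemma cyl_entropy_empty [simp]: "cyl_entropy M F {} = 0"
  by (simp add: cyl_entropy_def cyl_prob_def prob_space)

text \<open>Conditioning on the larger set \<open>I\<close> leaves no more entropy in the symbol at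
  \<open>a\<close> than conditioning on \<open>K\<close>. This is the Gibbs inequality for the law
  on \<open>insert a I\<close> against the weights \<open>?a\<close>, in which the symbol at
  \<open>a\<close> depends on the others through \<open>K\<close> only.\<close>

lemma cyl_entropy_submodular:
  assumes I: "finite I" "a \<notin> I" "K \<subseteq> I"
  shows "cyl_entropy M F (insert a I) + cyl_entropy M F K
    \<le> cyl_entropy M F I + cyl_entropy M F (insert a K)"
proof -
  let ?p = "cyl_prob M F" and ?J = "insert a I"
  let ?W = "PiE ?J (\<lambda>_. S)"
  let ?a = "\<lambda>w. ?p I w * (?p (insert a K) w / ?p K w)"
  have K: "finite K" "a \<notin> K" using I finite_subset by auto
  have fin: "finite ?W" using I finite_S by (intro finite_PiE) auto
  have pos: "?p I w > 0" "?p (insert a K) w > 0" "?p K w > 0" if "?p ?J w > 0" for w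
    using that I cyl_prob_antimono[of ?J I w] cyl_prob_antimono[of ?J "insert a K" w]
      cyl_prob_antimono[of ?J K w] by (auto simp: insert_mono subset_insertI2 intro: less_le_trans)
  have "(\<Sum>w\<in>?W. ?a w) = (\<Sum>w\<in>PiE I (\<lambda>_. S). \<Sum>s\<in>S. ?a (w(a := s)))"
    using I by (intro sum_PiE_insert)
  also have "\<dots> = (\<Sum>w\<in>PiE I (\<lambda>_. S). \<Sum>s\<in>S. ?p I w * (?p (insert a K) (w(a := s)) / ?p K w))"
    using I K by (intro sum.cong refl arg_cong2[where f = "(*)"] arg_cong2[where f = "(/)"] cyl_prob_cong) auto
  also have "\<dots> = (\<Sum>w\<in>PiE I (\<lambda>_. S). ?p I w * (\<Sum>s\<in>S. (?p (insert a K) (w(a := s)) / ?p K w)))"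
    by (simp only: sum_distrib_left)
  also have "\<dots> \<le> (\<Sum>w\<in>PiE I (\<lambda>_. S). ?p I w * 1)"
    by (intro sum_mono mult_left_mono sum_cyl_prob_ratio_le_1 K) auto
  also have "\<dots> = 1" using sum_cyl_prob[of I] I by simp
  finally have le1: "(\<Sum>w\<in>?W. ?a w) \<le> 1" .
  have "(\<Sum>w\<in>?W. ?p ?J w * ln (?a w)) - (\<Sum>w\<in>?W. ?p ?J w * ln (?p ?J w)) \<le> ln 1"
    using I pos by (intro gibbs_inequality fin le1 sum_cyl_prob) (auto intro!: mult_pos_pos divide_pos_pos)
  moreover have "(\<Sum>w\<in>?W. ?p ?J w * ln (?a w)) =
    (\<Sum>w\<in>?W. ?p ?J w * ln (?p I w) + ?p ?J w * ln (?p (insert a K) w) - ?p ?J w * ln (?p K w))"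
  proof (intro sum.cong refl)
    fix w
    show "?p ?J w * ln (?a w)
      = ?p ?J w * ln (?p I w) + ?p ?J w * ln (?p (insert a K) w) - ?p ?J w * ln (?p K w)"
    proof (cases "?p ?J w > 0")
      case True
      then show ?thesis using pos[OF True] by (simp add: ln_mult ln_div algebra_simps)
    next
      case False
      then have "?p ?J w = 0" using cyl_prob_nonneg[of M F ?J w] by linarith
      then show ?thesis by simp
    qed
  qed
  ultimately show ?thesis
    using I integral_ln_cyl_prob(2)[of ?J ?J] integral_ln_cyl_prob(2)[of ?J I]
      integral_ln_cyl_prob(2)[of ?J K] integral_ln_cyl_prob(2)[of ?J "insert a K"]
    by (simp add: sum.distrib sum_subtractf subset_insertI2 insert_mono)
qed

text \<open>As \<open>ln 0 = 0\<close>, logarithms of cylinder probabilities can only be compared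
  where these are positive; the exceptional points lie in finitely many null cylinders.\<close>

lemma AE_cyl_prob_pos:
  assumes "finite I"
  shows "AE x in M. cyl_prob M F I (\<lambda>i. F i x) > 0"
proof -
  let ?Z = "\<Union>w\<in>{w \<in> PiE I (\<lambda>_. S). cyl_prob M F I w = 0}. {x \<in> space M. \<forall>i\<in>I. F i x = w i}"
  have "?Z \<in> null_sets M"
    using assms finite_S
    by (intro null_sets_UN' countable_finite finite_subset[OF _ finite_PiE[of I "\<lambda>_. S"]])
      (auto simp: cyl_prob_def null_sets_def emeasure_eq_measure intro: cylinder_sets)
  then show ?thesis
  proof (rule AE_I', safe)
    fix x assume x: "x \<in> space M" "\<not> 0 < cyl_prob M F I (\<lambda>i. F i x)"
    then have "cyl_prob M F I (\<lambda>i. F i x) = 0" by (simp add: order.antisym not_less)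
    then show "x \<in> ?Z" using coding_in_S x by (intro UN_I[of "\<lambda>i\<in>I. F i x"]) auto
  qed
qed

lemma cyl_entropy_mono:
  assumes "finite I" "K \<subseteq> I"
  shows "cyl_entropy M F K \<le> cyl_entropy M F I"
proof -
  have "(\<integral>x. ln (cyl_prob M F I (\<lambda>i. F i x)) \<partial>M) \<le> (\<integral>x. ln (cyl_prob M F K (\<lambda>i. F i x)) \<partial>M)"
    using AE_cyl_prob_pos[OF assms(1)] assms
    by (intro integral_mono_AE integral_ln_cyl_prob(1)[OF assms(1)])
      (auto elim!: eventually_mono intro!: iffD2[OF ln_le_cancel_iff] cyl_prob_antimono
        intro: less_le_trans[OF _ cyl_prob_antimono])
  then show ?thesis by (simp add: cyl_entropy_def)
qed

end

section \<open>Measure-preserving systems\<close>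

lemma decseq_Cesaro:
  fixes d :: "nat \<Rightarrow> real"
  assumes "decseq d" and lim: "d \<longlonglongrightarrow> c"
  shows "(\<lambda>n. (\<Sum>i<n. d i) / real n) \<longlonglongrightarrow> c"
proof (rule LIMSEQ_I)
  fix r :: real assume r: "r > 0"
  have ge: "d i \<ge> c" for i using decseq_ge[OF assms] .
  obtain m where m: "d m < c + r / 2"
    using order_tendstoD(2)[OF lim, of "c + r / 2"] r by (auto simp: eventually_sequentially)
  let ?K = "\<Sum>i<m. d i - c"
  have K: "?K \<ge> 0" using ge by (intro sum_nonneg) auto
  obtain N where N: "real N > 2 * ?K / r" using reals_Archimedean2 by blast
  show "\<exists>no. \<forall>n\<ge>no. norm ((\<Sum>i<n. d i) / real n - c) < r"
  proof (intro exI allI impI)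
    fix n assume n: "max (N + 1) m \<le> n"
    then have n0: "n > 0" "m \<le> n" by auto
    have "(\<Sum>i<n. d i - c) = ?K + (\<Sum>i=m..<n. d i - c)"
      using sum.atLeastLessThan_concat[of 0 m n "\<lambda>i. d i - c"] n0 by (simp add: atLeast0LessThan)
    also have "(\<Sum>i=m..<n. d i - c) \<le> (\<Sum>i=m..<n. r / 2)"
    proof (rule sum_mono)
      fix i assume "i \<in> {m..<n}"
      then have "d i \<le> d m" using decseqD[OF assms(1)] by simp
      then show "d i - c \<le> r / 2" using m by linarith
    qed
    also have "\<dots> \<le> real n * (r / 2)" using r by (simp add: mult_right_mono)
    also have "?K < real n * (r / 2)"
    proof -
      have "2 * ?K / r < real n" using N n by linarith
      then show ?thesis using r by (simp add: pos_divide_less_eq)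
    qed
    finally have up: "(\<Sum>i<n. d i - c) < real n * r" by (simp add: field_simps)
    have lo: "(\<Sum>i<n. d i - c) \<ge> 0" using ge by (intro sum_nonneg) auto
    have "(\<Sum>i<n. d i) / real n - c = (\<Sum>i<n. d i - c) / real n"
      using n0 by (simp add: sum_subtractf field_simps)
    then show "norm ((\<Sum>i<n. d i) / real n - c) < r"
      using up lo n0 by (simp add: divide_less_eq mult.commute)
  qed
qed

locale pmp_system = prob_space M for M :: "'a measure" +
  fixes T :: "'a \<Rightarrow> 'a"
  assumes T_measurable [measurable]: "T \<in> measurable M M" and T_invariant: "distr M M T = M"
begin

lemma funpow_measurable [measurable]: "T ^^ n \<in> measurable M M"
  by (induction n) auto

lemma distr_funpow: "distr M M (T ^^ n) = M"
proof (induction n)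
  case 0
  then show ?case by (simp add: id_def distr_id)
next
  case (Suc n)
  have "distr M M (T ^^ Suc n) = distr (distr M M (T ^^ n)) M T"
    by (subst distr_distr) auto
  then show ?case using Suc T_invariant by (simp del: funpow.simps)
qed

lemma prob_vimage_funpow: "A \<in> sets M \<Longrightarrow> prob ((T ^^ n) -` A \<inter> space M) = prob A"
  using measure_distr[of "T ^^ n" M M A] distr_funpow by simp

lemma integral_funpow:
  fixes f :: "'a \<Rightarrow> real"
  shows "f \<in> borel_measurable M \<Longrightarrow> (\<integral>x. f ((T ^^ n) x) \<partial>M) = (\<integral>x. f x \<partial>M)"
  using integral_distr[of "T ^^ n" M M f] distr_funpow by simp

lemma integrable_funpow:
  fixes f :: "'a \<Rightarrow> real"
  shows "integrable M f \<Longrightarrow> integrable M (\<lambda>x. f ((T ^^ n) x))"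
  using integrable_distr[of "T ^^ n" M M f] distr_funpow by simp

lemma AE_funpow:
  assumes "AE x in M. Q x"
  shows "AE x in M. \<forall>n. Q ((T ^^ n) x)"
proof (subst AE_all_countable, intro allI)
  fix n
  have "AE x in distr M M (T ^^ n). Q x" using assms by (simp only: distr_funpow)
  then show "AE x in M. Q ((T ^^ n) x)" by (rule AE_distrD[rotated]) simp
qed

definition ergodic :: bool where
  "ergodic \<longleftrightarrow> (\<forall>A\<in>sets M. T -` A \<inter> space M = A \<longrightarrow> prob A = 0 \<or> prob A = 1)"

text \<open>In the proof, \<open>F N\<close> is the maximum of the Birkhoff sums of \<open>g = f - b\<close> of length at most \<open>N\<close>. Its
  limit is infinite on an invariant set, where \<open>F (Suc N) - F N \<circ> T = max (- (F N \<circ> T)) g\<close> tends to \<open>g\<close>; as the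
  left-hand side has nonnegative integral and \<open>g\<close> has negative integral, this set is null.\<close>

lemma ergodic_upper_bound:
  fixes f :: "'a \<Rightarrow> real"
  assumes "ergodic" and f[measurable]: "f \<in> borel_measurable M"
    and B: "\<And>x. \<bar>f x\<bar> \<le> B" and b: "(\<integral>x. f x \<partial>M) < b" and \<epsilon>: "\<epsilon> > 0"
  shows "\<exists>C. \<exists>G\<in>sets M. prob G > 1 - \<epsilon> \<and> (\<forall>x\<in>G. \<forall>n. (\<Sum>i<n. f ((T ^^ i) x)) \<le> real n * b + C)"
proof -
  define g where "g x = f x - b" for x
  have g[measurable]: "g \<in> borel_measurable M" unfolding g_def by measurable
  have gB: "\<bar>g x\<bar> \<le> B + \<bar>b\<bar>" for x using B[of x] by (simp add: g_def)
  \<comment> \<open>To maximise over the lengths up to \<open>Suc N\<close>, either stop at once or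
    take \<open>g x\<close> and continue from \<open>T x\<close>.\<close>
  define F where "F = rec_nat (\<lambda>_. 0) (\<lambda>N u x. max 0 (g x + u (T x)))"
  have F0: "F 0 x = 0" and FS: "F (Suc N) x = max 0 (g x + F N (T x))" for N x by (simp_all add: F_def)
  have F_nonneg: "F N x \<ge> 0" for N x by (cases N) (auto simp: F0 FS)
  have F_mono1: "F N x \<le> F (Suc N) x" for N x
    by (induction N arbitrary: x) (auto simp: F0 FS intro: max.coboundedI2)
  have F_meas[measurable]: "F N \<in> borel_measurable M" for N
  proof (induction N)
    case (Suc N)
    note [measurable] = Suc
    have "F (Suc N) = (\<lambda>x. max 0 (g x + F N (T x)))" by (auto simp: FS)
    then show ?case by simp
  qed (simp add: F_def)
  have F_bd: "F N x \<le> real N * (B + \<bar>b\<bar>)" for N x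
  proof (induction N arbitrary: x)
    case (Suc N)
    have "0 \<le> real (Suc N) * (B + \<bar>b\<bar>)" using gB[of x] by (intro mult_nonneg_nonneg) auto
    then show ?case using gB[of x] Suc[of "T x"] by (simp add: FS algebra_simps)
  qed (simp add: F0)
  have F_int: "integrable M (F N)" for N
    using F_bd F_nonneg by (intro integrable_const_bound[of _ "real N * (B + \<bar>b\<bar>)"]) auto
  have s_le_F: "(\<Sum>i<n. g ((T ^^ i) x)) \<le> F n x" for n x
  proof (induction n arbitrary: x)
    case (Suc n)
    have "(\<Sum>i<Suc n. g ((T ^^ i) x)) = g x + (\<Sum>i<n. g ((T ^^ i) (T x)))"
      by (simp add: sum.lessThan_Suc_shift funpow_swap1 del: sum.lessThan_Suc)
    then show ?case using Suc[of "T x"] by (simp add: FS)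
  qed (simp add: F0)
  define U where "U = {x \<in> space M. \<forall>c::nat. \<exists>N. real c < F N x}"
  have U_iff: "T x \<in> U \<longleftrightarrow> x \<in> U" if x: "x \<in> space M" for x
  proof -
    \<comment> \<open>Passing between \<open>x\<close> and \<open>T x\<close> changes the sums by at
      most the bound of \<open>g\<close>, so the thresholds are shifted by \<open>K\<close>.\<close>
    obtain K :: nat where K: "real K \<ge> B + \<bar>b\<bar>" using real_arch_simple by blast
    have "\<exists>N. real c < F N x" if h: "\<forall>c::nat. \<exists>N. real c < F N (T x)" for c :: nat
    proof -
      obtain N where "real (c + K) < F N (T x)" using h by blast
      then have "real c < F (Suc N) x" using gB[of x] K unfolding FS by simp
      then show ?thesis ..
    qed
    moreover have "\<exists>N. real c < F N (T x)" if h: "\<forall>c::nat. \<exists>N. real c < F N x" for c :: nat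
    proof -
      obtain N where N: "real (c + K) < F N x" using h by blast
      then obtain N' where "N = Suc N'" by (cases N) (auto simp: F0)
      then have "real c < F N' (T x)" using N gB[of x] K by (simp add: FS max_def split: if_splits)
      then show ?thesis ..
    qed
    ultimately show ?thesis using x measurable_space[OF T_measurable x] by (auto simp: U_def)
  qed
  have U_sets: "U \<in> sets M" unfolding U_def by measurable
  have "T -` U \<inter> space M = U" using U_iff by (auto simp: U_def)
  then have "prob U = 0 \<or> prob U = 1" using assms(1) U_sets by (auto simp: ergodic_def)
  moreover have "prob U \<noteq> 1"
  proof
    assume "prob U = 1"
    then have AE: "AE x in M. x \<in> U" using U_sets prob_eq_1 by blast
    have lim: "(\<lambda>N. \<integral>x. (F (Suc N) x - F N (T x)) \<partial>M) \<longlonglongrightarrow> (\<integral>x. g x \<partial>M)"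
    proof (rule integral_dominated_convergence[where w = "\<lambda>_. B + \<bar>b\<bar>"])
      show "AE x in M. (\<lambda>N. F (Suc N) x - F N (T x)) \<longlonglongrightarrow> g x"
        using AE
      proof (eventually_elim)
        fix x assume x: "x \<in> U"
        then have Tx: "T x \<in> U" using U_iff by (auto simp: U_def)
        obtain K :: nat where K: "real K \<ge> B + \<bar>b\<bar>" using real_arch_simple by blast
        obtain N0 where N0: "real K < F N0 (T x)" using Tx by (auto simp: U_def)
        \<comment> \<open>Beyond \<open>N0\<close> the value \<open>F N (T x)\<close> exceeds the
          bound of \<open>g\<close>, so the maximum with 0 in the recursion is inactive.\<close>
        have "F (Suc N) x - F N (T x) = g x" if "N \<ge> N0" for N
        proof -
          have "F N0 (T x) \<le> F N (T x)" using F_mono1 that by (rule lift_Suc_mono_le)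
          then show ?thesis using N0 K gB[of x] by (auto simp: FS)
        qed
        then show "(\<lambda>N. F (Suc N) x - F N (T x)) \<longlonglongrightarrow> g x"
          by (intro tendsto_eventually) (auto simp: eventually_sequentially)
      qed
      show "AE x in M. norm (F (Suc N) x - F N (T x)) \<le> B + \<bar>b\<bar>" for N
      proof (rule AE_I2)
        fix x
        show "norm (F (Suc N) x - F N (T x)) \<le> B + \<bar>b\<bar>"
          using gB[of x] F_nonneg[of N "T x"] by (simp add: FS max_def) linarith
      qed
    qed auto
    have "(\<integral>x. (F (Suc N) x - F N (T x)) \<partial>M) \<ge> 0" for N
    proof -
      have "(\<integral>x. (F (Suc N) x - F N (T x)) \<partial>M) = (\<integral>x. F (Suc N) x \<partial>M) - (\<integral>x. F N (T x) \<partial>M)"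
        using F_int integrable_funpow[OF F_int, of N 1] by (intro Bochner_Integration.integral_diff) auto
      also have "(\<integral>x. F N (T x) \<partial>M) = (\<integral>x. F N x \<partial>M)"
        using integral_funpow[OF F_meas, of N 1] by simp
      finally show ?thesis using integral_mono[OF F_int F_int, of N "Suc N"] F_mono1 by simp
    qed
    then have "(\<integral>x. g x \<partial>M) \<ge> 0" by (intro LIMSEQ_le_const[OF lim]) auto
    moreover have "integrable M f" using B by (intro integrable_const_bound[of _ B]) auto
    ultimately show False using b by (simp add: g_def prob_space)
  qed
  ultimately have U0: "prob U = 0" by simp
  \<comment> \<open>\<open>G c\<close> increases to the complement of the null set \<open>U\<close>,
    so a single constant \<open>c\<close> serves all \<open>n\<close> outside a set of measure less
    than \<open>\<epsilon>\<close>.\<close>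
  define G where "G c = {x \<in> space M. \<forall>N. F N x \<le> real c}" for c :: nat
  have G_sets: "G c \<in> sets M" for c unfolding G_def by measurable
  have "(\<lambda>c. prob (G c)) \<longlonglongrightarrow> prob (\<Union>c. G c)"
    by (intro finite_Lim_measure_incseq incseq_SucI) (auto simp: G_sets G_def intro: order_trans)
  moreover have "(\<Union>c. G c) = space M - U"
    unfolding G_def U_def by (auto simp flip: not_le)
  ultimately have "(\<lambda>c. prob (G c)) \<longlonglongrightarrow> 1"
    using prob_compl[OF U_sets] U0 by simp
  then have "eventually (\<lambda>c. 1 - \<epsilon> < prob (G c)) sequentially"
    using \<epsilon> by (intro order_tendstoD(1)) auto
  then obtain c where c: "prob (G c) > 1 - \<epsilon>"
    by (auto dest: eventually_happens)
  have "(\<Sum>i<n. f ((T ^^ i) x)) \<le> real n * b + real c" if "x \<in> G c" for n x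
  proof -
    have "F n x \<le> real c" using that by (simp add: G_def)
    with s_le_F[of x n] show ?thesis by (simp add: g_def sum_subtractf)
  qed
  then show ?thesis using c G_sets by blast
qed

end

section \<open>Entropy rate of a coding along the orbit\<close>

locale pmp_coding = pmp_system M T for M :: "'a measure" and T +
  fixes P :: "'a \<Rightarrow> 'b" and S :: "'b set"
  assumes finite_symbols: "finite S" and P_measurable [measurable]: "P \<in> measurable M (count_space S)"
begin

abbreviation itinerary :: "nat \<Rightarrow> 'a \<Rightarrow> 'b" where
  "itinerary i x \<equiv> P ((T ^^ i) x)"

sublocale finite_coding M itinerary S
  by unfold_locales (auto simp: finite_symbols)

lemma itinerary_add: "itinerary (k + i) x = itinerary i ((T ^^ k) x)"
  by (simp add: funpow_add add.commute[of k])

lemma cyl_prob_shift: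
  assumes "finite I"
  shows "cyl_prob M itinerary ((+) k ` I) w = cyl_prob M itinerary I (\<lambda>i. w (k + i))"
proof -
  have "{x \<in> space M. \<forall>i\<in>(+) k ` I. itinerary i x = w i}
      = (T ^^ k) -` {x \<in> space M. \<forall>i\<in>I. itinerary i x = w (k + i)} \<inter> space M"
    using measurable_space[OF funpow_measurable] by (auto simp: itinerary_add)
  then show ?thesis
    using prob_vimage_funpow[OF cylinder_sets[OF assms], of k "\<lambda>i. w (k + i)"] by (simp add: cyl_prob_def)
qed

lemma cyl_entropy_shift:
  assumes "finite I"
  shows "cyl_entropy M itinerary ((+) k ` I) = cyl_entropy M itinerary I"
proof -
  let ?g = "\<lambda>x. ln (cyl_prob M itinerary I (\<lambda>i. itinerary i x))"
  have "?g \<in> borel_measurable M"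
    using integral_ln_cyl_prob(1)[OF assms order_refl] by (rule borel_measurable_integrable)
  from integral_funpow[OF this, of k] show ?thesis
    unfolding cyl_entropy_def cyl_prob_shift[OF assms] itinerary_add by simp
qed

text \<open>The conditional entropy of the symbol at time \<open>n\<close> given all earlier
  symbols.\<close>

definition entropy_increment :: "nat \<Rightarrow> real" where
  "entropy_increment n = cyl_entropy M itinerary {..<Suc n} - cyl_entropy M itinerary {..<n}"

text \<open>Defined through the increments, since progressions are compared increment by increment;
  \<open>block_entropy_lim\<close> recovers the usual limit of block averages.\<close>

definition entropy_rate :: real where
  "entropy_rate = lim entropy_increment"

text \<open>Forgetting time 0 can only raise the conditional entropy of the symbol at
  \<open>Suc n\<close>, and by stationarity the result is the increment at \<open>n\<close>.\<close>

lemma decseq_entropy_increment: "decseq entropy_increment"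
proof (rule decseq_SucI)
  fix n
  have "cyl_entropy M itinerary (insert (Suc n) {..<Suc n}) + cyl_entropy M itinerary ((+) 1 ` {..<n})
    \<le> cyl_entropy M itinerary {..<Suc n} + cyl_entropy M itinerary (insert (Suc n) ((+) 1 ` {..<n}))"
    by (intro cyl_entropy_submodular) auto
  moreover have "insert (Suc n) ((+) 1 ` {..<n}) = (+) 1 ` {..<Suc n}" by (auto simp: lessThan_Suc)
  moreover have "insert (Suc n) {..<Suc n} = {..<Suc (Suc n)}" by auto
  ultimately show "entropy_increment (Suc n) \<le> entropy_increment n"
    using cyl_entropy_shift[of "{..<n}" 1] cyl_entropy_shift[of "{..<Suc n}" 1]
    by (simp add: entropy_increment_def del: lessThan_Suc)
qed

lemma entropy_increment_lim: "entropy_increment \<longlonglongrightarrow> entropy_rate"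
proof -
  have "\<forall>i. 0 \<le> entropy_increment i"
    using cyl_entropy_mono[of "{..<Suc n}" "{..<n}" for n] by (auto simp: entropy_increment_def)
  then show ?thesis
    using decseq_convergent[OF decseq_entropy_increment] unfolding entropy_rate_def
    by (metis limI)
qed

lemma entropy_rate_le_increment: "entropy_rate \<le> entropy_increment n"
  using decseq_ge[OF decseq_entropy_increment entropy_increment_lim] .

lemma sum_entropy_increment: "(\<Sum>i<n. entropy_increment i) = cyl_entropy M itinerary {..<n}"
  using sum_lessThan_telescope[of "\<lambda>n. cyl_entropy M itinerary {..<n}" n]
  by (simp add: entropy_increment_def del: lessThan_Suc)

lemma block_entropy_lim: "(\<lambda>n. cyl_entropy M itinerary {..<n} / real n) \<longlonglongrightarrow> entropy_rate"
  using decseq_Cesaro[OF decseq_entropy_increment entropy_increment_lim]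
  by (simp add: sum_entropy_increment)

text \<open>Given only the times \<open>0, q, ..., q * (n - 1)\<close>, the symbol at
  \<open>q * n\<close> has at least the conditional entropy that it has given all times below
  \<open>q * n\<close>, which is an increment and hence at least the rate.\<close>

lemma entropy_rate_arithmetic_progression:
  assumes "q \<ge> 1"
  shows "real n * entropy_rate \<le> cyl_entropy M itinerary ((*) q ` {..<n})"
proof (induction n)
  case (Suc n)
  have "cyl_entropy M itinerary (insert (q * n) {..<q * n}) + cyl_entropy M itinerary ((*) q ` {..<n})
    \<le> cyl_entropy M itinerary {..<q * n} + cyl_entropy M itinerary (insert (q * n) ((*) q ` {..<n}))"
    using assms by (intro cyl_entropy_submodular) auto
  moreover have "insert (q * n) ((*) q ` {..<n}) = (*) q ` {..<Suc n}" by (auto simp: lessThan_Suc)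
  moreover have "insert (q * n) {..<q * n} = {..<Suc (q * n)}" by auto
  ultimately show ?case
    using Suc entropy_rate_le_increment[of "q * n"] by (simp add: entropy_increment_def algebra_simps)
qed simp

end

section \<open>Counting itineraries by Markov weights\<close>

context finite_coding
begin

lemma finite_range_cyl_prob:
  assumes "finite I"
  shows "finite (range (cyl_prob M F I))"
proof -
  have "cyl_prob M F I w \<in> insert 0 (cyl_prob M F I ` PiE I (\<lambda>_. S))" for w
  proof (cases "\<forall>i\<in>I. w i \<in> S")
    case True
    then have "restrict w I \<in> PiE I (\<lambda>_. S)" by auto
    then show ?thesis by (metis cyl_prob_restrict imageI insertCI)
  next
    case False
    then obtain i where "i \<in> I" "w i \<notin> S" by blast
    then have "{x \<in> space M. \<forall>i\<in>I. F i x = w i} = {}" using coding_in_S[of _ i] by force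
    then show ?thesis unfolding cyl_prob_def by (simp only: measure_empty) simp
  qed
  then have "range (cyl_prob M F I) \<subseteq> insert 0 (cyl_prob M F I ` PiE I (\<lambda>_. S))" by blast
  moreover have "finite (PiE I (\<lambda>_. S))" using assms finite_S by (intro finite_PiE) auto
  ultimately show ?thesis by (simp add: finite_subset)
qed

lemma cyl_prob_measurable [measurable]:
  assumes "finite I"
  shows "(\<lambda>x. cyl_prob M F I (\<lambda>i. F i x)) \<in> borel_measurable M"
  using borel_measurable_integrable[OF integral_word(1)[OF assms, of "cyl_prob M F I"]] by simp

end

context pmp_coding
begin

text \<open>\<open>Q n\<close> is the \<open>m\<close>-step Markov weight without its initial distribution, hence the factor \<open>card S ^ m\<close>.\<close>

lemma sum_markov_weights:
  fixes m n :: nat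
  defines "Q \<equiv> \<lambda>n w. \<Prod>i<n. cyl_prob M itinerary ((+) i ` {..<Suc m}) w / cyl_prob M itinerary ((+) i ` {..<m}) w"
  shows "(\<Sum>w\<in>PiE {..<n + m} (\<lambda>_. S). Q n w) \<le> real (card S ^ m)"
proof (induction n)
  \<comment> \<open>The empty product leaves weight 1 for each of the \<open>card S ^ m\<close>
    initial words.\<close>
  case 0
  then show ?case by (simp add: Q_def card_PiE)
next
  case (Suc n)
  let ?c = "cyl_prob M itinerary"
  let ?J = "(+) n ` {..<m}"
  have J: "(+) n ` {..<Suc m} = insert (n + m) ?J" by (auto simp: lessThan_Suc)
  have "(\<Sum>w\<in>PiE {..<Suc n + m} (\<lambda>_. S). Q (Suc n) w)
    = (\<Sum>w\<in>PiE (insert (n + m) {..<n + m}) (\<lambda>_. S). Q (Suc n) w)"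
    by (simp add: lessThan_Suc)
  also have "\<dots> = (\<Sum>w\<in>PiE {..<n + m} (\<lambda>_. S). \<Sum>s\<in>S. Q (Suc n) (w(n + m := s)))"
    by (rule sum_PiE_insert) auto
  \<comment> \<open>The earlier factors read only indices below \<open>n + m\<close>, so appending a
    symbol there multiplies the weight by its conditional probability given the \<open>m\<close>
    symbols before it.\<close>
  also have "\<dots> = (\<Sum>w\<in>PiE {..<n + m} (\<lambda>_. S). \<Sum>s\<in>S. Q n w * (?c (insert (n + m) ?J) (w(n + m := s)) / ?c ?J w))"
  proof (intro sum.cong refl)
    fix w s
    have "Q n (w(n + m := s)) = Q n w"
      unfolding Q_def by (intro prod.cong refl arg_cong2[where f = "(/)"] cyl_prob_cong) auto
    moreover have "?c ?J (w(n + m := s)) = ?c ?J w" by (rule cyl_prob_cong) auto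
    ultimately show "Q (Suc n) (w(n + m := s)) = Q n w * (?c (insert (n + m) ?J) (w(n + m := s)) / ?c ?J w)"
      by (simp add: Q_def J del: lessThan_Suc fun_upd_apply)
  qed
  also have "\<dots> = (\<Sum>w\<in>PiE {..<n + m} (\<lambda>_. S). Q n w * (\<Sum>s\<in>S. ?c (insert (n + m) ?J) (w(n + m := s)) / ?c ?J w))"
    by (simp only: sum_distrib_left)
  also have "\<dots> \<le> (\<Sum>w\<in>PiE {..<n + m} (\<lambda>_. S). Q n w * 1)"
  proof (intro sum_mono mult_left_mono)
    fix w
    show "(\<Sum>s\<in>S. ?c (insert (n + m) ?J) (w(n + m := s)) / ?c ?J w) \<le> 1"
      by (rule sum_cyl_prob_ratio_le_1) auto
    show "0 \<le> Q n w" unfolding Q_def by (intro prod_nonneg divide_nonneg_nonneg ballI cyl_prob_nonneg)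
  qed
  finally show ?case using Suc by simp
qed

lemma card_words_le:
  assumes "ergodic" and b: "entropy_rate < b" and \<epsilon>: "\<epsilon> > 0"
  shows "\<exists>C. \<exists>G\<in>sets M. prob G > 1 - \<epsilon> \<and>
    (\<forall>n. real (card ((\<lambda>x. \<lambda>i\<in>{..<n}. itinerary i x) ` G)) \<le> C * exp (real n * b))"
proof -
  obtain m where m: "entropy_increment m < b"
    using order_tendstoD(2)[OF entropy_increment_lim b] by (auto dest: eventually_happens)
  let ?c = "cyl_prob M itinerary"
  let ?p = "\<lambda>k x. ?c {..<k} (\<lambda>i. itinerary i x)"
  \<comment> \<open>The information of the symbol at time \<open>m\<close> given the
    \<open>m\<close> symbols before it; its mean is \<open>entropy_increment m\<close>, hence below
    \<open>b\<close>.\<close>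
  define f where "f x = ln (?p m x) - ln (?p (Suc m) x)" for x
  have "range f \<subseteq> (\<lambda>(u, v). ln u - ln v) ` (range (?c {..<m}) \<times> range (?c {..<Suc m}))"
    by (auto simp: f_def)
  then have "finite (range f)"
    by (rule finite_subset) (intro finite_imageI finite_cartesian_product finite_range_cyl_prob finite_lessThan)
  then have bd: "\<bar>f x\<bar> \<le> Max (abs ` range f)" for x by (intro Max_ge) auto
  have int: "integrable M (\<lambda>x. ln (?p k x))" for k
    by (rule integral_ln_cyl_prob(1)[of "{..<k}"]) auto
  have [measurable]: "f \<in> borel_measurable M"
    unfolding f_def by (intro borel_measurable_integrable Bochner_Integration.integrable_diff int)
  have "(\<integral>x. f x \<partial>M) = (\<integral>x. ln (?p m x) \<partial>M) - (\<integral>x. ln (?p (Suc m) x) \<partial>M)"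
    unfolding f_def using int by (intro Bochner_Integration.integral_diff)
  then have "(\<integral>x. f x \<partial>M) < b"
    using m by (simp add: entropy_increment_def cyl_entropy_def del: lessThan_Suc)
  from ergodic_upper_bound[OF assms(1) _ bd this \<epsilon>] obtain C G
    where G: "G \<in> sets M" "prob G > 1 - \<epsilon>"
      and GC: "\<And>x n. x \<in> G \<Longrightarrow> (\<Sum>i<n. f ((T ^^ i) x)) \<le> real n * b + C" by auto
  \<comment> \<open>If a probability along the orbit vanished, \<open>ln 0 = 0\<close> would break
    the identity between \<open>exp (- f)\<close> and the ratio of probabilities. Such points form a
    null set.\<close>
  define G' where "G' = {x \<in> G. \<forall>i. ?p (Suc m) ((T ^^ i) x) > 0}"
  have [measurable]: "?p (Suc m) \<in> borel_measurable M" by (rule cyl_prob_measurable) simp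
  note [measurable] = G(1)
  have "G' = {x \<in> space M. x \<in> G \<and> (\<forall>i. ?p (Suc m) ((T ^^ i) x) > 0)}"
    using sets.sets_into_space[OF G(1)] by (auto simp: G'_def)
  then have G'_sets: "G' \<in> sets M" by simp
  have "AE x in M. \<forall>i. ?p (Suc m) ((T ^^ i) x) > 0"
    by (intro AE_funpow AE_cyl_prob_pos) simp
  then have "AE x in M. x \<in> G \<longleftrightarrow> x \<in> G'" by eventually_elim (auto simp: G'_def)
  then have "prob G' = prob G" using G(1) G'_sets by (intro finite_measure_eq_AE) auto
  then have G'_prob: "prob G' > 1 - \<epsilon>" using G by simp
  have "real (card ((\<lambda>x. \<lambda>i\<in>{..<n}. itinerary i x) ` G')) \<le> (real (card S ^ m) * exp C) * exp (real n * b)" for n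
  proof -
    define Q where "Q w = (\<Prod>i<n. ?c ((+) i ` {..<Suc m}) w / ?c ((+) i ` {..<m}) w)" for w
    \<comment> \<open>The last of the \<open>n\<close> factors reads up to index
      \<open>n + m - 1\<close>, hence the length \<open>n + m\<close>. The words of length
      \<open>n\<close> are restrictions of these, so not more numerous.\<close>
    define W where "W = (\<lambda>x. \<lambda>i\<in>{..<n + m}. itinerary i x) ` G'"
    have fin: "finite (PiE {..<n + m} (\<lambda>_. S))" using finite_S by (intro finite_PiE) auto
    have W: "W \<subseteq> PiE {..<n + m} (\<lambda>_. S)"
      unfolding W_def using coding_in_S sets.sets_into_space[OF G'_sets]
      by (intro image_subsetI restrict_PiE_iff[THEN iffD2] ballI) blast
    have Q_ge: "exp (- (real n * b + C)) \<le> Q w" if w_W: "w \<in> W" for w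
    proof -
      obtain x where x: "x \<in> G'" and w: "w = (\<lambda>i\<in>{..<n + m}. itinerary i x)"
        using w_W by (auto simp: W_def)
      have "Q w = (\<Prod>i<n. ?c ((+) i ` {..<Suc m}) (\<lambda>i. itinerary i x) / ?c ((+) i ` {..<m}) (\<lambda>i. itinerary i x))"
        unfolding Q_def w by (intro prod.cong refl arg_cong2[where f = "(/)"] cyl_prob_cong) auto
      also have "\<dots> = (\<Prod>i<n. ?p (Suc m) ((T ^^ i) x) / ?p m ((T ^^ i) x))"
        by (simp add: cyl_prob_shift itinerary_add del: lessThan_Suc)
      also have "\<dots> = (\<Prod>i<n. exp (- f ((T ^^ i) x)))"
      proof (intro prod.cong refl)
        fix i
        have pos: "?p (Suc m) ((T ^^ i) x) > 0" using x by (auto simp: G'_def simp del: lessThan_Suc)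
        also have "?p (Suc m) ((T ^^ i) x) \<le> ?p m ((T ^^ i) x)"
          by (intro cyl_prob_antimono) auto
        finally show "?p (Suc m) ((T ^^ i) x) / ?p m ((T ^^ i) x) = exp (- f ((T ^^ i) x))"
          using pos by (simp add: f_def exp_diff del: lessThan_Suc)
      qed
      also have "\<dots> = exp (- (\<Sum>i<n. f ((T ^^ i) x)))" by (simp add: exp_sum sum_negf[symmetric])
      finally show ?thesis using GC[of x n] x by (simp add: G'_def)
    qed
    have "real (card W) * exp (- (real n * b + C)) = (\<Sum>w\<in>W. exp (- (real n * b + C)))" by simp
    also have "\<dots> \<le> (\<Sum>w\<in>W. Q w)" using Q_ge by (rule sum_mono)
    also have "\<dots> \<le> (\<Sum>w\<in>PiE {..<n + m} (\<lambda>_. S). Q w)"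
      unfolding Q_def using fin W
      by (intro sum_mono2 prod_nonneg divide_nonneg_nonneg ballI cyl_prob_nonneg)
    also have "\<dots> \<le> real (card S ^ m)" unfolding Q_def by (rule sum_markov_weights)
    finally have "real (card W) \<le> real (card S ^ m) * exp (real n * b + C)"
      by (simp only: exp_minus) (simp add: field_simps)
    moreover have "card ((\<lambda>x. \<lambda>i\<in>{..<n}. itinerary i x) ` G') \<le> card W"
    proof (rule surj_card_le)
      show "finite W" using W fin by (rule finite_subset)
      show "(\<lambda>x. \<lambda>i\<in>{..<n}. itinerary i x) ` G' \<subseteq> (\<lambda>w. restrict w {..<n}) ` W"
        by (auto simp: W_def image_image intro!: image_eqI ext)
    qed
    ultimately show ?thesis by (simp add: exp_add algebra_simps)
  qed
  then show ?thesis using G'_sets G'_prob by blast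
qed

end

section \<open>Matched words\<close>

text \<open>An increasing map carries the sorted list of its domain to that of its image. A match is
  thus recorded by two sets alone.\<close>

lemma strict_mono_on_image_unique:
  fixes \<pi> \<rho> :: "nat \<Rightarrow> nat"
  assumes "finite D" "strict_mono_on D \<pi>" "strict_mono_on D \<rho>" "\<pi> ` D = \<rho> ` D" "i \<in> D"
  shows "\<pi> i = \<rho> i"
proof -
  have *: "sorted_list_of_set (f ` D) = map f (sorted_list_of_set D)" if "strict_mono_on D f" for f :: "nat \<Rightarrow> nat"
  proof -
    have "sorted_wrt (<) (map f (sorted_list_of_set D))"
      unfolding sorted_wrt_map using assms(1) strict_mono_onD[OF that]
      by (intro sorted_wrt_mono_rel[OF _ strict_sorted_list_of_set]) auto
    then show ?thesis
      using assms(1) by (intro strict_sorted_equal) auto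
  qed
  have "map \<pi> (sorted_list_of_set D) = map \<rho> (sorted_list_of_set D)"
    using *[OF assms(2)] *[OF assms(3)] assms(4) by simp
  then show ?thesis using assms(1,5) by simp
qed

text \<open>Complements turn these sets into sets of at most \<open>k\<close> elements; the additive
  condition avoids truncated subtraction.\<close>

lemma card_large_subsets:
  "card {D. D \<subseteq> {..<n} \<and> n \<le> card D + k} = (\<Sum>j\<le>k. n choose j)"
proof -
  have "bij_betw (\<lambda>D. {..<n} - D) {D. D \<subseteq> {..<n} \<and> n \<le> card D + k} (\<Union>j\<le>k. {B. B \<subseteq> {..<n} \<and> card B = j})"
    by (rule bij_betwI[where g = "\<lambda>D. {..<n} - D"])
      (auto simp: card_Diff_subset finite_subset[of _ "{..<n}"] double_diff)
  then have "card {D. D \<subseteq> {..<n} \<and> n \<le> card D + k} = card (\<Union>j\<le>k. {B. B \<subseteq> {..<n} \<and> card B = j})"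
    by (rule bij_betw_same_card)
  also have "\<dots> = (\<Sum>j\<le>k. card {B. B \<subseteq> {..<n} \<and> card B = j})"
    by (rule card_UN_disjoint) auto
  finally show ?thesis by (simp add: n_subsets)
qed

text \<open>A Chernoff bound: \<open>t ^ k \<le> t ^ j\<close> for \<open>j \<le> k\<close>, and the
  full binomial sum is \<open>(1 + t) ^ n\<close>. With \<open>t\<close> small and \<open>k\<close>
  a far smaller fraction of \<open>n\<close>, the exponent is a small multiple of
  \<open>n\<close>.\<close>

lemma sum_choose_le_exp:
  fixes t :: real
  assumes "0 < t" "t \<le> 1"
  shows "real (\<Sum>j\<le>k. n choose j) \<le> exp (real n * t + real k * ln (1 / t))"
proof -
  have "real (\<Sum>j\<le>k. n choose j) * t ^ k \<le> (\<Sum>j\<le>k. real (n choose j) * t ^ j)"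
    using assms by (auto simp: sum_distrib_right intro!: sum_mono mult_left_mono power_decreasing)
  also have "\<dots> \<le> (\<Sum>j\<le>max k n. real (n choose j) * t ^ j)"
    using assms by (intro sum_mono2) auto
  also have "\<dots> = (\<Sum>j\<le>n. real (n choose j) * t ^ j)"
    using assms by (intro sum.mono_neutral_right) auto
  also have "\<dots> = (t + 1) ^ n" by (simp add: binomial_ring)
  also have "\<dots> \<le> exp t ^ n" using assms exp_ge_add_one_self[of t] by (intro power_mono) (auto simp: add.commute)
  finally have "real (\<Sum>j\<le>k. n choose j) * t ^ k \<le> exp (real n * t)"
    by (simp add: exp_of_nat_mult)
  then have "real (\<Sum>j\<le>k. n choose j) \<le> exp (real n * t) / t ^ k"
    using assms by (simp add: pos_le_divide_eq)
  also have "\<dots> = exp (real n * t + real k * ln (1 / t))"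
    using assms by (simp add: exp_add exp_of_nat_mult power_inverse divide_inverse)
  finally show ?thesis .
qed

text \<open>For \<open>n > 0\<close>, the ball of radius \<open>k / n\<close> about \<open>a\<close>
  in Feldman's f-bar metric. The letters of \<open>a\<close> are arbitrary, because at some indices
  \<open>a\<close> will be a meaningless choice.\<close>

definition matched_words :: "nat \<Rightarrow> nat \<Rightarrow> 'b set \<Rightarrow> (nat \<Rightarrow> 'b) \<Rightarrow> (nat \<Rightarrow> 'b) set" where
  "matched_words n k S a = {w \<in> PiE {..<n} (\<lambda>_. S). \<exists>D \<pi>. D \<subseteq> {..<n} \<and> \<pi> ` D \<subseteq> {..<n} \<and>
     strict_mono_on D \<pi> \<and> n \<le> card D + k \<and> (\<forall>i\<in>D. w (\<pi> i) = a i)}"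

text \<open>A word is recovered from the domain and the image of its match, which determine the
  match and hence the matched letters, together with its at most \<open>k\<close> letters off the
  image. The square counts the pairs of domain and image.\<close>

lemma card_matched_words:
  assumes S: "finite S" "S \<noteq> {}"
  shows "card (matched_words n k S a) \<le> (\<Sum>j\<le>k. n choose j)\<^sup>2 * card S ^ k"
proof -
  let ?N = "matched_words n k S a"
  let ?L = "{D. D \<subseteq> {..<n} \<and> n \<le> card D + k}"
  have "\<forall>w. \<exists>D \<pi>. w \<in> ?N \<longrightarrow> D \<subseteq> {..<n} \<and> \<pi> ` D \<subseteq> {..<n} \<and>
     strict_mono_on D \<pi> \<and> n \<le> card D + k \<and> (\<forall>i\<in>D. w (\<pi> i) = a i)"
    by (simp add: matched_words_def)
  then obtain D \<pi> where w: "\<And>w. w \<in> ?N \<Longrightarrow> D w \<subseteq> {..<n} \<and> \<pi> w ` D w \<subseteq> {..<n} \<and>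
     strict_mono_on (D w) (\<pi> w) \<and> n \<le> card (D w) + k \<and> (\<forall>i\<in>D w. w (\<pi> w i) = a i)"
    by metis
  let ?code = "\<lambda>w. ((D w, \<pi> w ` D w), restrict w ({..<n} - \<pi> w ` D w))"
  let ?T = "SIGMA X:?L \<times> ?L. PiE ({..<n} - snd X) (\<lambda>_. S)"
  have finL: "finite ?L" by simp
  have card_im: "card (\<pi> w ` D w) = card (D w)" if "w \<in> ?N" for w
    using w[OF that] by (intro card_image strict_mono_on_imp_inj_on) auto
  have "inj_on ?code ?N"
  proof (rule inj_onI)
    fix v w assume v: "v \<in> ?N" and w': "w \<in> ?N" and eq: "?code v = ?code w"
    from eq have D: "D v = D w" and R: "\<pi> v ` D v = \<pi> w ` D w"
      and rest: "restrict v ({..<n} - \<pi> v ` D v) = restrict w ({..<n} - \<pi> v ` D v)" by auto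
    have fin: "finite (D v)" using w[OF v] finite_subset by blast
    have same: "\<pi> v i = \<pi> w i" if "i \<in> D v" for i
      using strict_mono_on_image_unique[OF fin, of "\<pi> v" "\<pi> w" i] w[OF v] w[OF w'] D R that by simp
    have "v j = w j" if "j < n" for j
    proof (cases "j \<in> \<pi> v ` D v")
      case True
      then obtain i where "i \<in> D v" "j = \<pi> v i" by auto
      then show ?thesis using w[OF v] w[OF w'] same D by metis
    next
      case False
      then show ?thesis using fun_cong[OF rest, of j] that by simp
    qed
    then show "v = w"
      using v w' by (intro PiE_ext[of v "{..<n}" "\<lambda>_. S" w]) (auto simp: matched_words_def)
  qed
  moreover have "?code ` ?N \<subseteq> ?T"
  proof (rule image_subsetI)
    fix v assume v: "v \<in> ?N"
    then have "v \<in> PiE {..<n} (\<lambda>_. S)" by (simp add: matched_words_def)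
    then show "?code v \<in> ?T" using w[OF v] card_im[OF v] by auto
  qed
  moreover have fin: "finite ?T"
    using finL S by (intro finite_SigmaI finite_cartesian_product finite_PiE) auto
  ultimately have "card ?N \<le> card ?T" by (rule card_inj_on_le)
  also have "card ?T = (\<Sum>X\<in>?L \<times> ?L. card (PiE ({..<n} - snd X) (\<lambda>_. S)))"
    using finL S by (intro card_SigmaI) (auto intro!: finite_PiE)
  also have "\<dots> \<le> (\<Sum>X\<in>?L \<times> ?L. card S ^ k)"
  proof (rule sum_mono)
    fix X assume "X \<in> ?L \<times> ?L"
    then have X: "snd X \<subseteq> {..<n}" "n \<le> card (snd X) + k" by auto
    then have "card ({..<n} - snd X) \<le> k" using finite_subset[OF X(1)] by (simp add: card_Diff_subset)
    moreover have "card S \<ge> 1" using S by (simp add: Suc_le_eq card_gt_0_iff)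
    ultimately show "card (PiE ({..<n} - snd X) (\<lambda>_. S)) \<le> card S ^ k"
      by (simp add: card_PiE power_increasing)
  qed
  also have "\<dots> = (\<Sum>j\<le>k. n choose j)\<^sup>2 * card S ^ k"
    by (simp add: card_cartesian_product card_large_subsets power2_eq_square)
  finally show ?thesis .
qed

section \<open>Feldman-Katok balls\<close>

lemma fk_gap_le_1: "fk_gap T q n \<delta> x y \<le> 1"
  by (simp add: fk_gap_def)

lemma fk_gap_less_iff:
  assumes "n > 0"
  shows "fk_gap T q n \<delta> x y < e \<longleftrightarrow>
    (\<exists>\<pi> D R. fk_match T q n \<delta> x y \<pi> D R \<and> real n * (1 - e) < real (card D))"
proof -
  let ?C = "{card D | \<pi> D R. fk_match T q n \<delta> x y \<pi> D R}"
  have "?C \<subseteq> {..n}"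
    by (auto simp: fk_match_def) (metis card_lessThan card_mono finite_lessThan)
  then have fin: "finite ?C" by (rule finite_subset) simp
  \<comment> \<open>The empty match ensures that the maximum is taken over a nonempty set.\<close>
  have "fk_match T q n \<delta> x y id {} {}" by (auto simp: fk_match_def strict_mono_on_def)
  then have ne: "?C \<noteq> {}" by blast
  have "fk_gap T q n \<delta> x y < e \<longleftrightarrow> real n * (1 - e) < real (Max ?C)"
    using assms by (simp add: fk_gap_def field_simps)
  also have "\<dots> \<longleftrightarrow> (\<exists>c\<in>?C. real n * (1 - e) < real c)"
    using Max_in[OF fin ne] Max_ge[OF fin] by (meson less_le_trans of_nat_le_iff)
  finally show ?thesis by blast
qed

lemma fk_ball_iff:
  "y \<in> fk_ball T q n x \<epsilon> \<longleftrightarrow> (\<exists>\<delta>. 0 < \<delta> \<and> \<delta> < \<epsilon> \<and> fk_gap T q n \<delta> x y < \<delta>)"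
proof -
  \<comment> \<open>The gap never exceeds 1, so \<open>2\<close> is always admissible and the
    infimum is over a nonempty set.\<close>
  have "2 \<in> {\<delta>. \<delta> > 0 \<and> fk_gap T q n \<delta> x y < \<delta>}"
    using fk_gap_le_1[of T q n 2 x y] by simp
  then have "{\<delta>. \<delta> > 0 \<and> fk_gap T q n \<delta> x y < \<delta>} \<noteq> {}" by blast
  moreover have "bdd_below {\<delta>. \<delta> > 0 \<and> fk_gap T q n \<delta> x y < \<delta>}" by (rule bdd_belowI[of _ 0]) auto
  ultimately show ?thesis
    unfolding fk_ball_def fk_dist_def by (auto simp: cInf_less_iff)
qed

lemma continuous_on_funpow:
  fixes T :: "'a::topological_space \<Rightarrow> 'a"
  shows "continuous_on UNIV T \<Longrightarrow> continuous_on UNIV (T ^^ n)"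
proof (induction n)
  case (Suc n)
  then show ?case using continuous_on_compose[of UNIV "T ^^ n" T] by (auto intro: continuous_on_subset)
qed (simp add: id_def)

text \<open>For a fixed radius and match, closeness is a finite set of open conditions on
  \<open>y\<close>; the ball is the union of these open sets over all radii and matches. Openness
  makes the balls Borel.\<close>

lemma open_fk_ball:
  assumes T: "continuous_on UNIV T" and n: "n > 0"
  shows "open (fk_ball T q n x \<epsilon>)"
proof -
  let ?V = "\<lambda>\<delta> \<pi> D. {y. \<forall>i\<in>D. dist ((T ^^ (q * i)) x) ((T ^^ (q * \<pi> i)) y) < \<delta>}"
  let ?I = "{(\<delta>, \<pi>, D). 0 < \<delta> \<and> \<delta> < \<epsilon> \<and> D \<subseteq> {..<n} \<and> \<pi> ` D \<subseteq> {..<n} \<and> strict_mono_on D \<pi> \<and>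
     real n * (1 - \<delta>) < real (card D)}"
  have "fk_ball T q n x \<epsilon> = (\<Union>(\<delta>, \<pi>, D)\<in>?I. ?V \<delta> \<pi> D)"
    unfolding set_eq_iff fk_ball_iff fk_gap_less_iff[OF n] fk_match_def
    by (auto simp: bij_betw_def dest: strict_mono_on_imp_inj_on) (blast dest: strict_mono_on_imp_inj_on)+
  moreover have "open (?V \<delta> \<pi> D)" if "D \<subseteq> {..<n}" for \<delta> \<pi> D
  proof -
    have "?V \<delta> \<pi> D = (\<Inter>i\<in>D. {y. dist ((T ^^ (q * i)) x) ((T ^^ (q * \<pi> i)) y) < \<delta>})" by auto
    also have "open \<dots>"
      using that by (intro open_INT ballI open_Collect_less continuous_intros continuous_on_funpow T)
        (auto intro: finite_subset)
    finally show ?thesis .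
  qed
  ultimately show ?thesis by (auto intro!: open_UN)
qed

lemma fk_ball_I:
  assumes "n > 0" "\<And>i. i < n \<Longrightarrow> dist ((T ^^ (q * i)) x) ((T ^^ (q * i)) y) \<le> r" "0 < r" "r < \<epsilon>"
  shows "y \<in> fk_ball T q n x \<epsilon>"
proof -
  \<comment> \<open>The midpoint lies strictly above \<open>r\<close>, as the strict inequality in a
    match requires, and strictly below \<open>\<epsilon>\<close>, as the ball requires.\<close>
  let ?\<delta> = "(r + \<epsilon>) / 2"
  have "dist ((T ^^ (q * i)) x) ((T ^^ (q * i)) y) < ?\<delta>" if "i < n" for i
    using assms(2)[OF that] assms(4) by simp
  then have "fk_match T q n ?\<delta> x y id {..<n} {..<n}"
    by (auto simp: fk_match_def strict_mono_on_def)
  then have "fk_gap T q n ?\<delta> x y < ?\<delta>"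
    unfolding fk_gap_less_iff[OF assms(1)] using assms
    by (intro exI[of _ id] exI[of _ "{..<n}"] conjI) auto
  then show ?thesis unfolding fk_ball_iff using assms by (intro exI[of _ ?\<delta>]) auto
qed

section \<open>Entropy and covers\<close>

text \<open>Approximating from both sides makes the property symmetric under complements, so that it
  can be carried from the open sets through the generated sigma-algebra.\<close>

lemma finite_measure_closed_open_approx:
  fixes M :: "'a::metric_space measure"
  assumes "finite_measure M" and M: "sets M = sets borel" and A: "A \<in> sets M" and "e > 0"
  shows "\<exists>K U. closed K \<and> open U \<and> K \<subseteq> A \<and> A \<subseteq> U \<and> measure M (U - K) < e"
proof -
  interpret finite_measure M by fact
  have A': "A \<in> sigma_sets UNIV {U. open U}" using A M by (simp add: borel_def)
  have borel: "B \<in> sets M" if "open B \<or> closed B" for B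
    using that borel_open borel_closed unfolding M by blast
  show ?thesis using A' \<open>e > 0\<close>
  proof (induction arbitrary: e rule: sigma_sets.induct)
    case (Basic A)
    then have A: "open A" by simp
    show ?case
    \<comment> \<open>The distance to the empty set is 0 by convention, so the sets
      \<open>K n\<close> below would not exhaust the whole space.\<close>
    proof (cases "A = UNIV")
      case True
      then show ?thesis using Basic by (intro exI[of _ UNIV]) auto
    next
      case False
      then have ne: "- A \<noteq> {}" by auto
      define K where "K n = {x. infdist x (- A) \<ge> inverse (real (Suc n))}" for n
      have K: "closed (K n)" for n unfolding K_def by (intro closed_Collect_le continuous_intros)
      have "(\<Union>n. K n) = A"
      proof
        show "(\<Union>n. K n) \<subseteq> A"
        proof (rule subsetI, rule ccontr)
          fix x assume "x \<in> (\<Union>n. K n)" "x \<notin> A"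
          then obtain n where "inverse (real (Suc n)) \<le> infdist x (- A)" "infdist x (- A) = 0"
            by (auto simp: K_def)
          moreover have "inverse (real (Suc n)) > 0" by simp
          ultimately show False by linarith
        qed
        show "A \<subseteq> (\<Union>n. K n)"
        proof
          fix x assume "x \<in> A"
          then have "infdist x (- A) > 0"
            using in_closed_iff_infdist_zero[OF _ ne, of x] A infdist_nonneg[of x "- A"] by (auto simp: less_le)
          then obtain n where "inverse (real (Suc n)) < infdist x (- A)" using reals_Archimedean by blast
          then show "x \<in> (\<Union>n. K n)" by (auto simp: K_def intro!: exI[of _ n])
        qed
      qed
      moreover have "incseq K" unfolding K_def
      proof (intro incseq_SucI Collect_mono impI)
        fix n x assume "inverse (real (Suc n)) \<le> infdist x (- A)"
        then show "inverse (real (Suc (Suc n))) \<le> infdist x (- A)"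
          by (rule order_trans[rotated]) (simp add: field_simps)
      qed
      ultimately have "(\<lambda>n. measure M (K n)) \<longlonglongrightarrow> measure M A"
        using finite_Lim_measure_incseq[of K] K borel by auto
      then have "eventually (\<lambda>n. measure M A - e < measure M (K n)) sequentially"
        using Basic by (intro order_tendstoD(1)) auto
      then obtain n where n: "measure M A - e < measure M (K n)" by (auto dest: eventually_happens)
      have "K n \<subseteq> A" using \<open>(\<Union>n. K n) = A\<close> by auto
      then have "measure M (A - K n) < e"
        using n finite_measure_Diff[of A "K n"] borel A K by auto
      then show ?thesis using K A \<open>K n \<subseteq> A\<close> by blast
    qed
  next
    case Empty
    then show ?case by (intro exI[of _ "{}"]) auto
  next
    case (Compl A)
    from Compl.IH[OF Compl.prems] obtain K U
      where KU: "closed K" "open U" "K \<subseteq> A" "A \<subseteq> U" "measure M (U - K) < e"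
      by (elim exE conjE)
    have "- K - - U = U - K" by auto
    then have "closed (- U) \<and> open (- K) \<and> - U \<subseteq> UNIV - A \<and> UNIV - A \<subseteq> - K \<and> measure M (- K - - U) < e"
      using KU by auto
    then show ?case by (intro exI)
  next
    case (Union A)
    \<comment> \<open>Half of \<open>e\<close> is spread over the members of the union. The other
      half pays for keeping finitely many \<open>K i\<close>, as an infinite union of closed sets
      need not be closed.\<close>
    have "\<forall>i. \<exists>K U. closed K \<and> open U \<and> K \<subseteq> A i \<and> A i \<subseteq> U \<and> measure M (U - K) < e / 2 / 2 ^ Suc i"
      using Union by simp
    then obtain K U where KU: "\<And>i. closed (K i)" "\<And>i. open (U i)" "\<And>i. K i \<subseteq> A i" "\<And>i. A i \<subseteq> U i"
      "\<And>i. measure M (U i - K i) < e / 2 / 2 ^ Suc i"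
      by metis
    let ?U = "\<Union>i. U i" and ?K = "\<lambda>N. \<Union>i<N. K i" and ?D = "\<Union>i. U i - K i"
    have D_sets: "U i - K i \<in> sets M" for i using KU borel by blast
    have geo: "(\<lambda>i. e / 2 / 2 ^ Suc i) sums (e / 2)"
      using sums_mult[OF power_half_series, of "e / 2"] by (simp add: power_divide)
    have summ: "summable (\<lambda>i. measure M (U i - K i))"
      using KU(5) by (intro summable_comparison_test'[OF sums_summable[OF geo], of 0]) (auto intro: less_imp_le)
    have "measure M ?D \<le> (\<Sum>i. measure M (U i - K i))"
      using D_sets summ by (intro finite_measure_subadditive_countably) auto
    also have "\<dots> \<le> e / 2"
      using KU(5) geo summ by (intro suminf_le[OF _ summ sums_summable[OF geo], unfolded sums_unique[OF geo, symmetric]])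
        (auto intro: less_imp_le)
    finally have D: "measure M ?D \<le> e / 2" .
    have Usets: "?U \<in> sets M" using KU borel by auto
    have Ksets: "?K N \<in> sets M" "(\<Union>i. K i) \<in> sets M" for N using KU borel by auto
    have "(\<lambda>N. measure M (?K N)) \<longlonglongrightarrow> measure M (\<Union>N. ?K N)"
    proof (rule finite_Lim_measure_incseq)
      show "range ?K \<subseteq> sets M" using Ksets by blast
      show "incseq ?K" by (intro monoI UN_mono) auto
    qed
    moreover have "(\<Union>N. ?K N) = (\<Union>i. K i)" by auto
    ultimately have "eventually (\<lambda>N. measure M (\<Union>i. K i) - e / 2 < measure M (?K N)) sequentially"
      using Union.prems by (intro order_tendstoD(1)) auto
    then obtain N where N: "measure M (\<Union>i. K i) - e / 2 < measure M (?K N)" by (auto dest: eventually_happens)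
    have "measure M (?U - ?K N) \<le> measure M (?D \<union> ((\<Union>i. K i) - ?K N))"
      using D_sets Ksets by (intro finite_measure_mono) auto
    also have "\<dots> \<le> measure M ?D + measure M ((\<Union>i. K i) - ?K N)"
      using D_sets Ksets by (intro measure_Un_le) auto
    also have "measure M ((\<Union>i. K i) - ?K N) = measure M (\<Union>i. K i) - measure M (?K N)"
      using Ksets by (intro finite_measure_Diff) auto
    finally have "measure M (?U - ?K N) < e" using D N by linarith
    moreover have "closed (?K N)" using KU by auto
    moreover have "?K N \<subseteq> (\<Union>i. A i)" "(\<Union>i. A i) \<subseteq> ?U"
      by (intro UN_mono KU subset_UNIV)+
    moreover have "open ?U" using KU(2) by (intro open_UN) auto
    ultimately show ?case by blast
  qed
qed

section \<open>Entropy against weighted covers\<close>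

context finite_coding
begin

text \<open>An abstract form of the comparison: \<open>N j\<close> stands for the words seen in the
  \<open>j\<close>-th ball, \<open>\<psi>\<close> for the Birkhoff sum, \<open>e j\<close> for its
  value at the centre, and \<open>\<theta>\<close> bounds the measure of the discarded
  points.\<close>

lemma entropy_cover_bound:
  fixes \<psi> :: "'a \<Rightarrow> real" and e :: "'j \<Rightarrow> real"
  assumes I: "finite I" and S: "S \<noteq> {}" and J: "finite J" "J \<noteq> {}"
    and N: "\<And>j. j \<in> J \<Longrightarrow> N j \<subseteq> PiE I (\<lambda>_. S)" "\<And>j. j \<in> J \<Longrightarrow> real (card (N j)) \<le> L"
    and \<psi>: "\<psi> \<in> borel_measurable M" "\<And>x. \<bar>\<psi> x\<bar> \<le> B"
    and e: "\<And>j. j \<in> J \<Longrightarrow> - B \<le> e j"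
    and G: "G \<in> sets M" "1 - \<theta> \<le> prob G"
    and cov: "\<And>x. x \<in> G \<Longrightarrow> \<exists>j\<in>J. (\<lambda>i\<in>I. F i x) \<in> N j \<and> \<psi> x \<le> e j + \<tau>" and \<tau>: "0 \<le> \<tau>"
  shows "cyl_entropy M F I + (\<integral>x. \<psi> x \<partial>M)
    \<le> ln (\<Sum>j\<in>J. exp (e j)) + ln (L + 1) + \<tau> + \<theta> * (2 * B + real (card I) * ln (real (card S)))"
proof -
  let ?W = "PiE I (\<lambda>_. S)" and ?p = "cyl_prob M F I"
  let ?E = "\<Sum>j\<in>J. exp (e j)" and ?r = "real (card S ^ card I)"
  let ?K = "2 * B + real (card I) * ln (real (card S))"
  \<comment> \<open>The last summand only keeps the weight of the words outside \<open>\<Union>j. N j\<close> positive.\<close>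
  define a where "a w = (\<Sum>j\<in>J. exp (e j) * indicator (N j) w) + exp (- B) / ?r" for w
  have fin: "finite ?W" using I finite_S by (intro finite_PiE) auto
  have cS: "card S \<ge> 1" using S finite_S by (simp add: Suc_le_eq card_gt_0_iff)
  then have r: "?r \<ge> 1" by simp
  have cW: "real (card ?W) = ?r" using I by (simp add: card_PiE)
  obtain j0 where j0: "j0 \<in> J" using J by blast
  have L: "L \<ge> 0" using N(2)[OF j0] by linarith
  have B: "B \<ge> 0" using \<psi>(2)[of undefined] by linarith
  \<comment> \<open>The uniform part of the weights has total \<open>exp (- B)\<close>; bounding it
    by \<open>?E\<close> is what turns \<open>L\<close> into \<open>L + 1\<close>.\<close>
  have E: "exp (- B) \<le> ?E"
  proof -
    have "exp (- B) \<le> exp (e j0)" using e[OF j0] by simp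
    also have "\<dots> \<le> ?E" using J j0 by (intro member_le_sum) auto
    finally show ?thesis .
  qed
  then have E_pos: "?E > 0" using exp_gt_zero[of "- B"] by linarith
  have a_pos: "a w > 0" for w
    unfolding a_def using r by (intro add_nonneg_pos sum_nonneg divide_pos_pos) (use cS in auto)
  have "(\<Sum>w\<in>?W. a w) = (\<Sum>j\<in>J. \<Sum>w\<in>?W. exp (e j) * indicator (N j) w) + exp (- B)"
    unfolding a_def sum.distrib using cW r cS by (subst sum.swap) simp
  also have "(\<Sum>j\<in>J. \<Sum>w\<in>?W. exp (e j) * indicator (N j) w) = (\<Sum>j\<in>J. exp (e j) * real (card (N j)))"
  proof (rule sum.cong[OF refl])
    fix j assume "j \<in> J"
    then have "?W \<inter> N j = N j" using N(1) by blast
    then show "(\<Sum>w\<in>?W. exp (e j) * indicator (N j) w) = exp (e j) * real (card (N j))"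
      using fin by (simp add: sum_distrib_left[symmetric] indicator_def of_bool_def sum.If_cases Int_def)
  qed
  also have "\<dots> \<le> (\<Sum>j\<in>J. exp (e j) * L)" using N by (intro sum_mono mult_left_mono) auto
  also have "\<dots> = L * ?E" by (simp add: sum_distrib_left mult.commute)
  finally have Z: "(\<Sum>w\<in>?W. a w) \<le> (L + 1) * ?E" using E by (simp add: algebra_simps)
  have "(\<Sum>w\<in>?W. ?p w * ln (a w)) - (\<Sum>w\<in>?W. ?p w * ln (?p w)) \<le> ln ((L + 1) * ?E)"
    using L E_pos a_pos by (intro gibbs_inequality fin sum_cyl_prob I Z) (auto intro: less_imp_le)
  also have "\<dots> = ln ?E + ln (L + 1)" using L E_pos by (simp add: ln_mult)
  finally have main: "(\<integral>x. ln (a (\<lambda>i\<in>I. F i x)) \<partial>M) + cyl_entropy M F I \<le> ln ?E + ln (L + 1)"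
    using integral_ln_cyl_prob(2)[OF I order_refl] integral_word(2)[OF I, of "\<lambda>w. ln (a w)"] by simp
  have \<psi>_int: "integrable M \<psi>" using \<psi> by (intro integrable_const_bound[of _ B]) auto
  have G': "space M - G \<in> sets M" using G by auto
  have int: "integrable M (\<lambda>x. \<psi> x - \<tau> - ?K * indicator (space M - G) x)"
    using \<psi>_int G' by (intro Bochner_Integration.integrable_diff integrable_mult_right) (auto simp: less_top[symmetric])
  have "(\<integral>x. (\<psi> x - \<tau> - ?K * indicator (space M - G) x) \<partial>M) \<le> (\<integral>x. ln (a (\<lambda>i\<in>I. F i x)) \<partial>M)"
  proof (rule integral_mono[OF int integral_word(1)[OF I]])
    fix x assume x: "x \<in> space M"
    let ?w = "\<lambda>i\<in>I. F i x"
    show "\<psi> x - \<tau> - ?K * indicator (space M - G) x \<le> ln (a ?w)"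
    proof (cases "x \<in> G")
      case True
      then obtain j where j: "j \<in> J" "?w \<in> N j" "\<psi> x \<le> e j + \<tau>" using cov by blast
      have "exp (e j) = exp (e j) * indicator (N j) ?w" using j by simp
      also have "\<dots> \<le> (\<Sum>j\<in>J. exp (e j) * indicator (N j) ?w)" using J j by (intro member_le_sum) auto
      also have "\<dots> \<le> a ?w" unfolding a_def by simp
      finally have "e j \<le> ln (a ?w)" using a_pos by (simp add: ln_ge_iff)
      then show ?thesis using j True by simp
    next
      \<comment> \<open>Off \<open>G\<close> only the uniform part of the weight is available; its
        logarithm is below \<open>\<psi> x\<close> by at most \<open>?K\<close>.\<close>
      case False
      have "exp (- B) / ?r \<le> a ?w" unfolding a_def by (simp add: sum_nonneg)
      then have "ln (exp (- B) / ?r) \<le> ln (a ?w)" using cS by (intro ln_mono divide_pos_pos) auto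
      moreover have "ln (exp (- B) / ?r) = - B - real (card I) * ln (real (card S))"
        using cS r by (simp add: ln_div ln_realpow)
      ultimately show ?thesis using False x \<psi>(2)[of x] \<tau> by simp
    qed
  qed
  also have "(\<integral>x. (\<psi> x - \<tau> - ?K * indicator (space M - G) x) \<partial>M)
      = (\<integral>x. \<psi> x \<partial>M) - \<tau> - ?K * prob (space M - G)"
    using \<psi>_int G' by (simp add: prob_space less_top[symmetric] Int_absorb2)
  finally have "(\<integral>x. \<psi> x \<partial>M) \<le> (\<integral>x. ln (a (\<lambda>i\<in>I. F i x)) \<partial>M) + \<tau> + ?K * prob (space M - G)" by linarith
  moreover have "?K * prob (space M - G) \<le> ?K * \<theta>"
    using prob_compl[OF G(1)] G(2) B cS by (intro mult_left_mono) auto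
  ultimately show ?thesis using main by (simp add: mult.commute[of \<theta>])
qed

end

section \<open>Partitions as codings, and Kolmogorov-Sinai entropy\<close>

locale pmp_partition = pmp_system M T for M :: "'a measure" and T +
  fixes \<xi> :: "'a set set"
  assumes partition: "\<xi> \<in> finite_partitions M"
begin

definition cell :: "'a \<Rightarrow> 'a set" where
  "cell x = (THE A. A \<in> \<xi> \<and> x \<in> A)"

lemma cell_eq: "A \<in> \<xi> \<Longrightarrow> x \<in> A \<Longrightarrow> cell x = A"
  using partition unfolding cell_def finite_partitions_def partition_on_def disjoint_def
  by (intro the_equality) blast+

lemma cell_in: "x \<in> space M \<Longrightarrow> cell x \<in> \<xi> \<and> x \<in> cell x"
  using partition cell_eq[of _ x] by (auto simp: finite_partitions_def partition_on_def) blast+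

sublocale pmp_coding M T cell \<xi>
proof
  show fin: "finite \<xi>" using partition by (simp add: finite_partitions_def)
  show "cell \<in> measurable M (count_space \<xi>)"
  proof (rule measurable_count_space_eq2[THEN iffD2, OF fin], intro conjI ballI)
    show "cell \<in> space M \<rightarrow> \<xi>" using cell_in by auto
    fix A assume A: "A \<in> \<xi>"
    then have "cell -` {A} \<inter> space M = A"
      using partition cell_eq cell_in by (auto simp: finite_partitions_def partition_on_def)
    then show "cell -` {A} \<inter> space M \<in> sets M"
      using A partition by (auto simp: finite_partitions_def)
  qed
qed

text \<open>The join is a set of cells, so words with empty cell must be set aside before cells and
  words correspond one to one; they add 0 to the sum over all words.\<close>

lemma partition_entropy_iterated_join:
  "partition_entropy M (iterated_join M T \<xi> n) = cyl_entropy M itinerary {..<n}"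
proof -
  let ?C = "\<lambda>w. {x \<in> space M. \<forall>i<n. (T ^^ i) x \<in> w i}"
  let ?W = "PiE {..<n} (\<lambda>_. \<xi>)"
  let ?B = "{w \<in> ?W. ?C w \<noteq> {}}"
  let ?h = "\<lambda>A. measure M A * ln (measure M A)"
  have fin: "finite ?W" using finite_symbols by (intro finite_PiE) auto
  have C_eq: "?C w = {x \<in> space M. \<forall>i\<in>{..<n}. itinerary i x = w i}" if "w \<in> ?W" for w
  proof -
    have "(T ^^ i) x \<in> w i \<longleftrightarrow> itinerary i x = w i" if "x \<in> space M" "i < n" for x i
      using cell_in[of "(T ^^ i) x"] cell_eq[of "w i" "(T ^^ i) x"] \<open>w \<in> ?W\<close> that
        measurable_space[OF funpow_measurable] by (auto simp: PiE_iff)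
    then show ?thesis by auto
  qed
  have "iterated_join M T \<xi> n = ?C ` ?B"
  proof
    show "iterated_join M T \<xi> n \<subseteq> ?C ` ?B"
    proof
      fix A assume "A \<in> iterated_join M T \<xi> n"
      then obtain c where c: "A = ?C c" "\<forall>i<n. c i \<in> \<xi>" "A \<noteq> {}" by (auto simp: iterated_join_def)
      then have "A = ?C (restrict c {..<n})" "restrict c {..<n} \<in> ?W" by auto
      then show "A \<in> ?C ` ?B" using c(3) by blast
    qed
    show "?C ` ?B \<subseteq> iterated_join M T \<xi> n"
      unfolding iterated_join_def by (auto simp: PiE_iff)
  qed
  moreover have "inj_on ?C ?B"
  proof (rule inj_onI)
    fix v w assume v: "v \<in> ?B" and w: "w \<in> ?B" and eq: "?C v = ?C w"
    then obtain x where x: "x \<in> ?C v" by blast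
    then have "x \<in> {x \<in> space M. \<forall>i\<in>{..<n}. itinerary i x = v i}" using C_eq[of v] v by blast
    moreover have "x \<in> {x \<in> space M. \<forall>i\<in>{..<n}. itinerary i x = w i}" using C_eq[of w] w x eq by blast
    ultimately show "v = w" using v w by (intro PiE_ext[of v "{..<n}" "\<lambda>_. \<xi>" w]) auto
  qed
  ultimately have "partition_entropy M (iterated_join M T \<xi> n) = - (\<Sum>w\<in>?B. ?h (?C w))"
    by (simp add: partition_entropy_def sum.reindex)
  also have "(\<Sum>w\<in>?B. ?h (?C w)) = (\<Sum>w\<in>?W. ?h (?C w))"
  proof (rule sum.mono_neutral_left[OF fin])
    show "\<forall>w\<in>?W - ?B. ?h (?C w) = 0"
    proof
      fix w assume "w \<in> ?W - ?B"
      then have "?C w = {}" by blast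
      then show "?h (?C w) = 0" by (simp only: measure_empty mult_zero_left)
    qed
  qed blast
  also have "\<dots> = (\<Sum>w\<in>?W. ?h {x \<in> space M. \<forall>i\<in>{..<n}. itinerary i x = w i})"
    by (intro sum.cong refl arg_cong[where f = ?h] C_eq)
  finally show ?thesis
    using integral_ln_cyl_prob(2)[of "{..<n}" "{..<n}"] by (simp add: cyl_prob_def)
qed

lemma entropy_wrt_partition_eq: "entropy_wrt_partition M T \<xi> = ereal entropy_rate"
  unfolding entropy_wrt_partition_def partition_entropy_iterated_join
  using block_entropy_lim by (intro limI) simp

lemma entropy_rate_le_ks: "ereal entropy_rate \<le> ks_entropy M T"
  unfolding ks_entropy_def entropy_wrt_partition_eq[symmetric] using partition by (rule SUP_upper)

end

text \<open>Each matched pair costs at most \<open>\<eta>\<close>. Each orbit has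
  \<open>n - card D\<close> unmatched times, costing at most \<open>B\<close> each, whence the
  factor 2.\<close>

lemma birkhoff_sum_match:
  assumes match: "fk_match T q n \<delta> x y \<pi> D R"
    and B: "\<And>u. \<bar>\<phi> u\<bar> \<le> B" and \<eta>: "0 \<le> \<eta>" and unif: "\<And>u v. dist u v < \<delta> \<Longrightarrow> \<bar>\<phi> u - \<phi> v\<bar> \<le> \<eta>"
  shows "birkhoff_sum T q n \<phi> y
    \<le> birkhoff_sum T q n \<phi> x + real n * \<eta> + 2 * B * (real n - real (card D))"
proof -
  let ?f = "\<lambda>x i. \<phi> ((T ^^ (q * i)) x)"
  have D: "D \<subseteq> {..<n}" "R \<subseteq> {..<n}" "bij_betw \<pi> D R"
    and d: "\<And>i. i \<in> D \<Longrightarrow> dist ((T ^^ (q * i)) x) ((T ^^ (q * \<pi> i)) y) < \<delta>"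
    using match by (auto simp: fk_match_def)
  have fin: "finite D" "finite R" using D finite_subset by blast+
  have cD: "card D \<le> n" using card_mono[OF finite_lessThan D(1)] by simp
  have cR: "card R = card D" using bij_betw_same_card[OF D(3)] by simp
  have "birkhoff_sum T q n \<phi> y = sum (?f y) R + sum (?f y) ({..<n} - R)"
    unfolding birkhoff_sum_def using D by (subst sum.subset_diff[of R]) auto
  also have "sum (?f y) ({..<n} - R) \<le> (\<Sum>i\<in>{..<n} - R. B)"
    using B by (intro sum_mono) (auto simp: abs_le_iff)
  also have "\<dots> = B * (real n - real (card D))"
    using D fin cD cR by (simp add: card_Diff_subset of_nat_diff mult.commute)
  also have "sum (?f y) R = (\<Sum>i\<in>D. ?f y (\<pi> i))"
    using sum.reindex_bij_betw[OF D(3), of "?f y"] by simp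
  also have "\<dots> \<le> (\<Sum>i\<in>D. ?f x i + \<eta>)"
  proof (rule sum_mono)
    fix i assume "i \<in> D"
    from unif[OF d[OF this]] show "?f y (\<pi> i) \<le> ?f x i + \<eta>" by linarith
  qed
  also have "\<dots> = sum (?f x) D + real (card D) * \<eta>" by (simp add: sum.distrib)
  also have "sum (?f x) D \<le> birkhoff_sum T q n \<phi> x + B * (real n - real (card D))"
  proof -
    have "birkhoff_sum T q n \<phi> x = sum (?f x) D + sum (?f x) ({..<n} - D)"
      unfolding birkhoff_sum_def using D by (subst sum.subset_diff[of D]) auto
    moreover have "(\<Sum>i\<in>{..<n} - D. - B) \<le> sum (?f x) ({..<n} - D)"
      using B by (intro sum_mono) (auto simp: abs_le_iff minus_le_iff)
    moreover have "(\<Sum>i\<in>{..<n} - D. - B) = - B * (real n - real (card D))"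
      using D fin cD by (simp add: card_Diff_subset of_nat_diff algebra_simps)
    ultimately show ?thesis by (simp add: algebra_simps)
  qed
  also have "real (card D) * \<eta> \<le> real n * \<eta>"
    using cD \<eta> by (intro mult_right_mono) auto
  finally show ?thesis by (simp add: algebra_simps)
qed

lemma compact_closed_separation:
  fixes K L :: "'a::metric_space set"
  assumes "compact K" "closed L" "K \<inter> L = {}"
  shows "\<exists>d>0. \<forall>x\<in>K. \<forall>y\<in>L. d \<le> dist x y"
proof (cases "K = {} \<or> L = {}")
  case True
  then show ?thesis by (auto intro: exI[of _ 1])
next
  case False
  then obtain x0 where x0: "x0 \<in> K" "\<And>x. x \<in> K \<Longrightarrow> infdist x0 L \<le> infdist x L"
    using continuous_attains_inf[OF assms(1), of "\<lambda>x. infdist x L"] continuous_on_infdist[OF continuous_on_id]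
    by (metis (no_types))
  have "infdist x0 L \<noteq> 0"
    using in_closed_iff_infdist_zero[OF assms(2), of x0] False x0(1) assms(3) by blast
  then have "infdist x0 L > 0" using infdist_nonneg[of x0 L] by linarith
  moreover have "infdist x0 L \<le> dist x y" if "x \<in> K" "y \<in> L" for x y
    using x0(2)[OF that(1)] infdist_le[OF that(2), of x] by linarith
  ultimately show ?thesis by blast
qed

section \<open>Finite covers and the upper bound\<close>

locale compact_ergodic_system = pmp_system M T for M :: "'a::metric_space measure" and T +
  assumes compact_UNIV: "compact (UNIV :: 'a set)" and continuous_T: "continuous_on UNIV T"
    and sets_M: "sets M = sets borel" and ergodic: ergodic
begin

lemma space_M [simp]: "space M = UNIV"
  using sets_eq_imp_space_eq[OF sets_M] by simp

lemma continuous_measurable: "continuous_on UNIV f \<Longrightarrow> f \<in> borel_measurable M"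
  using borel_measurable_continuous_onI[of f] measurable_cong_sets[OF sets_M refl] by blast

lemma continuous_bounded:
  fixes f :: "'a \<Rightarrow> real"
  assumes "continuous_on UNIV f"
  obtains B where "\<And>x. \<bar>f x\<bar> \<le> B"
proof -
  have "bounded (range f)" using compact_continuous_image[OF assms compact_UNIV] by (rule compact_imp_bounded)
  then show ?thesis using that by (auto simp: bounded_iff)
qed

lemma fk_ball_sets [measurable]: "n > 0 \<Longrightarrow> fk_ball T q n x \<epsilon> \<in> sets M"
  unfolding sets_M using open_fk_ball[OF continuous_T] by simp

lemma fine_partition:
  assumes "r > 0"
  shows "\<exists>\<xi>\<in>finite_partitions M. \<forall>A\<in>\<xi>. \<forall>x\<in>A. \<forall>y\<in>A. dist x y \<le> r"
proof -
  have cover: "(UNIV :: 'a set) \<subseteq> (\<Union>c\<in>UNIV. ball c (r / 2))"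
  proof (rule subsetI)
    fix x :: 'a
    have "x \<in> ball x (r / 2)" using assms by simp
    then show "x \<in> (\<Union>c\<in>UNIV. ball c (r / 2))" by blast
  qed
  obtain C :: "'a set" where C: "finite C" "UNIV \<subseteq> (\<Union>c\<in>C. ball c (r / 2))"
  proof (rule compactE_image[OF compact_UNIV _ cover])
    show "open (ball c (r / 2))" for c :: 'a by simp
  next
    fix C' :: "'a set"
    assume "finite C'" "UNIV \<subseteq> (\<Union>c\<in>C'. ball c (r / 2))"
    then show thesis by (rule that)
  qed
  obtain cs where cs: "set cs = C" using finite_list[OF C(1)] by blast
  \<comment> \<open>The finite list of balls is continued by empty sets because
    \<open>disjointed\<close> acts on sequences.\<close>
  define A where "A i = (if i < length cs then ball (cs ! i) (r / 2) else {})" for i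
  have A_sets: "range A \<subseteq> sets M" unfolding A_def sets_M by auto
  have sets: "disjointed A i \<in> sets M" for i
    using sets.range_disjointed_sets[OF A_sets] by blast
  have diam: "dist x y \<le> r" if "x \<in> disjointed A i" "y \<in> disjointed A i" for x y i
  proof -
    have "x \<in> A i" "y \<in> A i" using that disjointed_subset[of A i] by auto
    then have "dist (cs ! i) x < r / 2" "dist (cs ! i) y < r / 2" by (auto simp: A_def split: if_splits)
    then show ?thesis using dist_triangle2[of x y "cs ! i"] by (simp add: dist_commute)
  qed
  let ?\<xi> = "disjointed A ` {0..<length cs} - {{}}"
  have "(\<Union>i\<in>{0..<length cs}. A i) = UNIV"
  proof -
    have "x \<in> (\<Union>i\<in>{0..<length cs}. A i)" for x
    proof -
      obtain c where "c \<in> C" "x \<in> ball c (r / 2)" using C(2) by blast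
      then obtain i where "i < length cs" "cs ! i = c" using cs by (metis in_set_conv_nth)
      then show ?thesis using \<open>x \<in> ball c (r / 2)\<close> by (auto simp: A_def)
    qed
    then show ?thesis by blast
  qed
  moreover have "\<Union> (\<S> - {{}}) = \<Union> \<S>" for \<S> :: "'a set set" by auto
  ultimately have "\<Union> ?\<xi> = UNIV" using finite_UN_disjointed_eq[of A "length cs"] by simp
  moreover have "disjoint ?\<xi>"
    unfolding disjoint_def
  proof (intro ballI impI)
    fix a b assume "a \<in> ?\<xi>" "b \<in> ?\<xi>" and ab: "a \<noteq> b"
    then obtain i j where "a = disjointed A i" "b = disjointed A j" by blast
    then show "a \<inter> b = {}"
      using ab disjoint_family_onD[OF disjoint_family_disjointed, of i j A] by auto
  qed
  ultimately have "?\<xi> \<in> finite_partitions M"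
    using sets by (auto simp: finite_partitions_def partition_on_def)
  then show ?thesis using diam by (intro bexI[of _ ?\<xi>]) auto
qed

text \<open>One centre is picked in \<open>G\<close> for each word seen in \<open>G\<close>. Points
  with the same word are close at every time, so the identity matches all indices, and centres in
  \<open>G\<close> inherit the bound on Birkhoff sums.\<close>

lemma fk_cover_of_words:
  fixes F :: "nat \<Rightarrow> 'a \<Rightarrow> 'b"
  assumes n: "n > 0" and F: "\<And>i x y. F i x = F i y \<Longrightarrow> dist ((T ^^ (q * i)) x) ((T ^^ (q * i)) y) \<le> r"
    and r: "0 < r" "r < \<epsilon>" "\<epsilon> \<le> 1"
    and W: "finite ((\<lambda>x. \<lambda>i\<in>{..<n}. F i x) ` G)"
    and G: "G \<in> sets M" "prob G > 1 - \<epsilon>" and s: "\<And>x. x \<in> G \<Longrightarrow> birkhoff_sum T q n \<phi> x \<le> s"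
  shows "\<exists>(k::nat) x. k \<ge> 1 \<and> prob (\<Union>i\<in>{1..k}. fk_ball T q n (x i) \<epsilon>) > 1 - \<epsilon> \<and>
    (\<Sum>i=1..k. exp (birkhoff_sum T q n \<phi> (x i))) \<le> real (card ((\<lambda>x. \<lambda>i\<in>{..<n}. F i x) ` G)) * exp s"
proof -
  let ?word = "\<lambda>x. \<lambda>i\<in>{..<n}. F i x"
  let ?W = "?word ` G"
  obtain h where h: "bij_betw h {1..card ?W} ?W"
    using ex_bij_betw_nat_finite_1[OF W] by blast
  define x where "x i = (SOME y. y \<in> G \<and> ?word y = h i)" for i
  have x: "x i \<in> G \<and> ?word (x i) = h i" if "i \<in> {1..card ?W}" for i
  proof -
    have "h i \<in> ?W" using h that by (auto simp: bij_betw_def)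
    then have "\<exists>y. y \<in> G \<and> ?word y = h i" by auto
    then show ?thesis unfolding x_def by (rule someI_ex)
  qed
  have "G \<noteq> {}" using G r by auto
  then have "card ?W \<ge> 1" using W by (simp add: Suc_le_eq card_gt_0_iff)
  moreover have "G \<subseteq> (\<Union>i\<in>{1..card ?W}. fk_ball T q n (x i) \<epsilon>)"
  proof
    fix y assume y: "y \<in> G"
    then have "?word y \<in> h ` {1..card ?W}" using bij_betw_imp_surj_on[OF h] by blast
    then obtain i where i: "i \<in> {1..card ?W}" "h i = ?word y" by (elim imageE) simp
    have "y \<in> fk_ball T q n (x i) \<epsilon>"
    proof (rule fk_ball_I[OF n _ r(1,2)])
      fix j assume j: "j < n"
      have "?word (x i) = ?word y" using x[OF i(1)] i(2) by simp
      then have "?word (x i) j = ?word y j" by (rule fun_cong)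
      then have "F j (x i) = F j y" using j by simp
      then show "dist ((T ^^ (q * j)) (x i)) ((T ^^ (q * j)) y) \<le> r" by (rule F)
    qed
    then show "y \<in> (\<Union>i\<in>{1..card ?W}. fk_ball T q n (x i) \<epsilon>)" using i by blast
  qed
  then have "prob G \<le> prob (\<Union>i\<in>{1..card ?W}. fk_ball T q n (x i) \<epsilon>)"
    using n by (intro finite_measure_mono sets.finite_UN) auto
  moreover have "(\<Sum>i=1..card ?W. exp (birkhoff_sum T q n \<phi> (x i))) \<le> (\<Sum>i=1..card ?W. exp s)"
    using x s by (intro sum_mono) auto
  ultimately show ?thesis using G by (intro exI[of _ "card ?W"] exI[of _ x]) auto
qed

abbreviation fk_cover_sums where
  "fk_cover_sums q n \<phi> \<epsilon> \<equiv> {(\<Sum>i=1..k. exp (birkhoff_sum T q n \<phi> (x i))) | (k::nat) (x :: nat \<Rightarrow> 'a).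
            k \<ge> 1 \<and> prob (\<Union>i\<in>{1..k}. fk_ball T q n (x i) \<epsilon>) > 1 - \<epsilon>}"

text \<open>A real infimum over the empty set would carry no information, so every \<open>q\<close>
  must admit a finite cover; the words of a fine partition read along \<open>q\<close> provide
  one.\<close>

lemma fk_cover_sums_nonempty:
  assumes "continuous_on UNIV \<phi>" "n > 0" "0 < \<epsilon>" "\<epsilon> \<le> 1"
  shows "fk_cover_sums q n \<phi> \<epsilon> \<noteq> {}"
proof -
  obtain B where B: "\<And>x. \<bar>\<phi> x\<bar> \<le> B" using continuous_bounded[OF assms(1)] by blast
  obtain \<xi> where \<xi>: "\<xi> \<in> finite_partitions M" "\<And>A x y. A \<in> \<xi> \<Longrightarrow> x \<in> A \<Longrightarrow> y \<in> A \<Longrightarrow> dist x y \<le> \<epsilon> / 2"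
    using fine_partition[of "\<epsilon> / 2"] assms by auto
  interpret pmp_partition M T \<xi> by unfold_locales fact
  let ?F = "\<lambda>i x. cell ((T ^^ (q * i)) x)"
  have "(\<lambda>x. \<lambda>i\<in>{..<n}. ?F i x) ` UNIV \<subseteq> PiE {..<n} (\<lambda>_. \<xi>)"
    using cell_in by auto
  then have fin: "finite ((\<lambda>x. \<lambda>i\<in>{..<n}. ?F i x) ` UNIV)"
    using finite_symbols by (elim finite_subset) (auto intro!: finite_PiE)
  have *: "birkhoff_sum T q n \<phi> x \<le> real n * B" for x
    unfolding birkhoff_sum_def using B
    by (intro order_trans[OF sum_bounded_above[of _ _ B]]) (auto simp: abs_le_iff)
  have "dist ((T ^^ (q * i)) x) ((T ^^ (q * i)) y) \<le> \<epsilon> / 2" if "?F i x = ?F i y" for i x y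
    using that cell_in[of "(T ^^ (q * i)) x"] cell_in[of "(T ^^ (q * i)) y"]
    by (intro \<xi>(2)[of "?F i x"]) auto
  from fk_cover_of_words[of n ?F q "\<epsilon> / 2" \<epsilon> UNIV \<phi> "real n * B", OF assms(2) this _ _ assms(4) fin _ _ *]
  obtain k :: nat and x where "k \<ge> 1" "prob (\<Union>i\<in>{1..k}. fk_ball T q n (x i) \<epsilon>) > 1 - \<epsilon>"
    using assms prob_space sets.top[of M] by auto
  then show ?thesis by blast
qed

lemma fk_cover_sum_inf_ge:
  assumes "continuous_on UNIV \<phi>" "n > 0" "0 < \<epsilon>" "\<epsilon> \<le> 1"
    and "\<And>q (k::nat) x. q \<ge> 1 \<Longrightarrow> k \<ge> 1 \<Longrightarrow> prob (\<Union>i\<in>{1..k}. fk_ball T q n (x i) \<epsilon>) > 1 - \<epsilon> \<Longrightarrow>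
      c \<le> (\<Sum>i=1..k. exp (birkhoff_sum T q n \<phi> (x i)))"
  shows "c \<le> fk_cover_sum_inf T n \<phi> M \<epsilon>"
  unfolding fk_cover_sum_inf_def
proof (rule cINF_greatest)
  fix q :: nat assume "q \<in> {1..}"
  then have q: "q \<ge> 1" by simp
  have "c \<le> u" if u: "u \<in> fk_cover_sums q n \<phi> \<epsilon>" for u
  proof -
    obtain k :: nat and x where "u = (\<Sum>i=1..k. exp (birkhoff_sum T q n \<phi> (x i)))" "k \<ge> 1"
      "prob (\<Union>i\<in>{1..k}. fk_ball T q n (x i) \<epsilon>) > 1 - \<epsilon>"
      using u by blast
    then show ?thesis using assms(5)[OF q] by blast
  qed
  then show "c \<le> fk_cover_sum T q n \<phi> M \<epsilon>"
    unfolding fk_cover_sum_def using fk_cover_sums_nonempty[OF assms(1-4)] by (rule cInf_greatest[rotated])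
qed auto

lemma fk_cover_sum_inf_le:
  assumes "continuous_on UNIV \<phi>" "n > 0" "0 < \<epsilon>" "\<epsilon> \<le> 1" "q \<ge> 1"
    and k: "(k::nat) \<ge> 1" "prob (\<Union>i\<in>{1..k}. fk_ball T q n (x i) \<epsilon>) > 1 - \<epsilon>"
  shows "fk_cover_sum_inf T n \<phi> M \<epsilon> \<le> (\<Sum>i=1..k. exp (birkhoff_sum T q n \<phi> (x i)))"
proof -
  have "0 \<le> fk_cover_sum T q' n \<phi> M \<epsilon>" for q'
    unfolding fk_cover_sum_def using assms
    by (intro cInf_greatest fk_cover_sums_nonempty) (auto intro!: sum_nonneg)
  then have "fk_cover_sum_inf T n \<phi> M \<epsilon> \<le> fk_cover_sum T q n \<phi> M \<epsilon>"
    unfolding fk_cover_sum_inf_def using assms(5) by (intro cINF_lower bdd_belowI2[of _ 0]) auto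
  also have "\<dots> \<le> (\<Sum>i=1..k. exp (birkhoff_sum T q n \<phi> (x i)))"
    unfolding fk_cover_sum_def
  proof (rule cInf_lower)
    show "(\<Sum>i=1..k. exp (birkhoff_sum T q n \<phi> (x i))) \<in> fk_cover_sums q n \<phi> \<epsilon>" using k by blast
    show "bdd_below (fk_cover_sums q n \<phi> \<epsilon>)" by (rule bdd_belowI[of _ 0]) (auto intro!: sum_nonneg)
  qed
  finally show ?thesis .
qed

text \<open>Needed to take logarithms monotonically. One term of a cover sum is already at least
  \<open>exp (- (n * B))\<close>, whatever \<open>q\<close> is.\<close>

lemma fk_cover_sum_inf_pos:
  assumes "continuous_on UNIV \<phi>" "n > 0" "0 < \<epsilon>" "\<epsilon> \<le> 1"
  shows "fk_cover_sum_inf T n \<phi> M \<epsilon> > 0"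
proof -
  obtain B where B: "\<And>x. \<bar>\<phi> x\<bar> \<le> B" using continuous_bounded[OF assms(1)] by blast
  have "exp (- (real n * B)) \<le> fk_cover_sum_inf T n \<phi> M \<epsilon>"
  proof (rule fk_cover_sum_inf_ge[OF assms])
    fix q k and x :: "nat \<Rightarrow> 'a" assume k: "(k::nat) \<ge> 1"
    have "- (real n * B) = (\<Sum>i<n. - B)" by simp
    also have "\<dots> \<le> birkhoff_sum T q n \<phi> (x 1)"
      unfolding birkhoff_sum_def using B by (intro sum_mono) (auto simp: abs_le_iff minus_le_iff)
    finally have "exp (- (real n * B)) \<le> exp (birkhoff_sum T q n \<phi> (x 1))" by simp
    also have "\<dots> \<le> (\<Sum>i=1..k. exp (birkhoff_sum T q n \<phi> (x i)))"
      using k by (intro member_le_sum) auto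
    finally show "exp (- (real n * B)) \<le> (\<Sum>i=1..k. exp (birkhoff_sum T q n \<phi> (x i)))" .
  qed
  then show ?thesis using exp_gt_zero[of "- (real n * B)"] by linarith
qed

text \<open>The partition depends on \<open>\<epsilon>\<close>, but its entropy rate never exceeds
  the supremum, so the bound holds at each fixed \<open>\<epsilon>\<close> before any limit.\<close>

lemma limsup_fk_le:
  assumes \<phi>: "continuous_on UNIV \<phi>" and \<epsilon>: "0 < \<epsilon>" "\<epsilon> \<le> 1"
  shows "limsup (\<lambda>n. ereal (ln (fk_cover_sum_inf T n \<phi> M \<epsilon>) / real n))
    \<le> ks_entropy M T + ereal (integral\<^sup>L M \<phi>)"
proof -
  obtain B where B: "\<And>x. \<bar>\<phi> x\<bar> \<le> B" using continuous_bounded[OF \<phi>] by blast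
  obtain \<xi> where \<xi>: "\<xi> \<in> finite_partitions M" "\<And>A x y. A \<in> \<xi> \<Longrightarrow> x \<in> A \<Longrightarrow> y \<in> A \<Longrightarrow> dist x y \<le> \<epsilon> / 2"
    using fine_partition[of "\<epsilon> / 2"] \<epsilon> by auto
  interpret pmp_partition M T \<xi> by unfold_locales fact
  have F: "dist ((T ^^ (1 * i)) x) ((T ^^ (1 * i)) y) \<le> \<epsilon> / 2" if "itinerary i x = itinerary i y" for i x y
    unfolding mult_1 using that cell_in[of "(T ^^ i) x"] cell_in[of "(T ^^ i) y"]
    by (intro \<xi>(2)[of "itinerary i x"]) auto
  let ?c = "entropy_rate + integral\<^sup>L M \<phi>"
  let ?u = "\<lambda>n. ln (fk_cover_sum_inf T n \<phi> M \<epsilon>) / real n"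
  have "limsup (\<lambda>n. ereal (?u n)) \<le> ereal ?c + ereal e" if e: "e > 0" for e
  proof -
    \<comment> \<open>\<open>G1\<close> controls the number of words and \<open>G2\<close> the
      Birkhoff sums at the centres; each takes half of the allowed measure and half of
      \<open>e\<close>.\<close>
    obtain C1 G1 where G1: "G1 \<in> sets M" "prob G1 > 1 - \<epsilon> / 2"
      and C1: "\<And>n. real (card ((\<lambda>x. \<lambda>i\<in>{..<n}. itinerary i x) ` G1)) \<le> C1 * exp (real n * (entropy_rate + e / 2))"
      using card_words_le[OF ergodic, of "entropy_rate + e / 2" "\<epsilon> / 2"] \<epsilon> e by auto
    obtain C2 G2 where G2: "G2 \<in> sets M" "prob G2 > 1 - \<epsilon> / 2"
      and C2: "\<And>x n. x \<in> G2 \<Longrightarrow> (\<Sum>i<n. \<phi> ((T ^^ i) x)) \<le> real n * (integral\<^sup>L M \<phi> + e / 2) + C2"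
      using ergodic_upper_bound[OF ergodic continuous_measurable[OF \<phi>] B, of "integral\<^sup>L M \<phi> + e / 2" "\<epsilon> / 2"] \<epsilon> e
      by auto
    let ?G = "G1 \<inter> G2"
    have G: "prob ?G > 1 - \<epsilon>"
    proof -
      have "prob (G1 \<union> G2) \<le> 1" by simp
      moreover have "prob (G1 \<union> G2) = prob G1 + prob G2 - prob ?G"
        using G1 G2 by (simp add: finite_measure_Union')  (simp add: finite_measure_Diff' Int_commute)
      ultimately show ?thesis using G1 G2 by linarith
    qed
    have bound: "fk_cover_sum_inf T n \<phi> M \<epsilon> \<le> C1 * exp (real n * (?c + e) + C2)" if n: "n > 0" for n
    proof -
      let ?W = "\<lambda>G. (\<lambda>x. \<lambda>i\<in>{..<n}. itinerary i x) ` G"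
      have sub: "?W G1 \<subseteq> PiE {..<n} (\<lambda>_. \<xi>)"
        using cell_in by auto
      have fin: "finite (?W G1)"
        using finite_symbols by (intro finite_subset[OF sub] finite_PiE) auto
      have fin': "finite (?W ?G)" by (rule finite_subset[OF _ fin]) auto
      obtain k :: nat and x where k: "k \<ge> 1" "prob (\<Union>i\<in>{1..k}. fk_ball T 1 n (x i) \<epsilon>) > 1 - \<epsilon>"
        and sum: "(\<Sum>i=1..k. exp (birkhoff_sum T 1 n \<phi> (x i)))
          \<le> real (card (?W ?G)) * exp (real n * (integral\<^sup>L M \<phi> + e / 2) + C2)"
        using fk_cover_of_words[of n itinerary 1 "\<epsilon> / 2" \<epsilon> ?G \<phi> "real n * (integral\<^sup>L M \<phi> + e / 2) + C2",
          OF n F _ _ \<epsilon>(2) fin' _ G] C2 \<epsilon> G1 G2 by (auto simp: birkhoff_sum_def)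
      have "fk_cover_sum_inf T n \<phi> M \<epsilon> \<le> (\<Sum>i=1..k. exp (birkhoff_sum T 1 n \<phi> (x i)))"
        using n \<epsilon> k by (intro fk_cover_sum_inf_le \<phi>) auto
      also note sum
      also have "real (card (?W ?G)) \<le> real (card (?W G1))" using fin by (intro of_nat_mono card_mono) auto
      also note C1[of n]
      finally show ?thesis by (simp add: exp_add[symmetric] algebra_simps)
    qed
    \<comment> \<open>The sign of \<open>C1\<close> is not part of how it was obtained; the bound at
      \<open>n = 1\<close> and positivity of the cover sum force it.\<close>
    have C1_pos: "C1 > 0"
    proof -
      have "0 < C1 * exp (real 1 * (?c + e) + C2)"
        using fk_cover_sum_inf_pos[OF \<phi> _ \<epsilon>, of 1] bound[of 1] by linarith
      then show ?thesis by (simp add: zero_less_mult_iff)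
    qed
    have le: "?u n \<le> ?c + e + (ln C1 + C2) / real n" if n: "n > 0" for n
    proof -
      have "ln (fk_cover_sum_inf T n \<phi> M \<epsilon>) \<le> ln (C1 * exp (real n * (?c + e) + C2))"
        using bound[OF n] fk_cover_sum_inf_pos[OF \<phi> n \<epsilon>] by (intro ln_mono) auto
      also have "\<dots> = ln C1 + (real n * (?c + e) + C2)" using C1_pos by (simp add: ln_mult)
      finally have "?u n \<le> (ln C1 + (real n * (?c + e) + C2)) / real n" using n by (intro divide_right_mono) auto
      also have "\<dots> = ?c + e + (ln C1 + C2) / real n" using n by (simp add: field_simps)
      finally show ?thesis .
    qed
    have "(\<lambda>n. ?c + e + (ln C1 + C2) / real n) \<longlonglongrightarrow> ?c + e + 0"
      by (intro tendsto_intros lim_const_over_n)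
    then have lim: "(\<lambda>n. ereal (?c + e + (ln C1 + C2) / real n)) \<longlonglongrightarrow> ereal (?c + e)" by simp
    have "limsup (\<lambda>n. ereal (?u n)) \<le> limsup (\<lambda>n. ereal (?c + e + (ln C1 + C2) / real n))"
      using le by (intro Limsup_mono) (auto simp: eventually_sequentially intro!: exI[of _ 1])
    also have "\<dots> = ereal (?c + e)" using lim by (intro lim_imp_Limsup) auto
    finally show ?thesis by simp
  qed
  then have "limsup (\<lambda>n. ereal (?u n)) \<le> ereal ?c" by (rule ereal_le_epsilon2)
  also have "\<dots> = ereal entropy_rate + ereal (integral\<^sup>L M \<phi>)" by simp
  also have "\<dots> \<le> ks_entropy M T + ereal (integral\<^sup>L M \<phi>)"
    using entropy_rate_le_ks by (intro add_right_mono)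
  finally show ?thesis .
qed

end

section \<open>The lower bound\<close>

locale compact_partition = compact_ergodic_system M T + pmp_partition M T \<xi>
  for M :: "'a::metric_space measure" and T and \<xi>
begin

text \<open>Disjoint cells may be at distance 0, but disjoint compact sets inside them are not. Each
  of the finitely many cells loses an equal share of \<open>e\<close>.\<close>

lemma partition_closed_approx:
  assumes "e > 0"
  shows "\<exists>K d. d > 0 \<and> (\<forall>A\<in>\<xi>. closed (K A) \<and> K A \<subseteq> A) \<and> prob (- (\<Union>A\<in>\<xi>. K A)) \<le> e \<and>
    (\<forall>A\<in>\<xi>. \<forall>B\<in>\<xi>. \<forall>x\<in>K A. \<forall>y\<in>K B. A \<noteq> B \<longrightarrow> d \<le> dist x y)"
proof -
  have \<xi>: "\<And>A. A \<in> \<xi> \<Longrightarrow> A \<in> sets M" "\<Union>\<xi> = UNIV" "disjoint \<xi>"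
    using partition by (auto simp: finite_partitions_def partition_on_def)
  let ?e = "e / real (card \<xi> + 1)"
  have e: "?e > 0" using assms by simp
  have "\<exists>K. closed K \<and> K \<subseteq> A \<and> prob (A - K) \<le> ?e" if A: "A \<in> \<xi>" for A
  proof -
    obtain K U where KU: "closed K" "open U" "K \<subseteq> A" "A \<subseteq> U" "prob (U - K) < ?e"
      using finite_measure_closed_open_approx[OF finite_measure_axioms sets_M \<xi>(1)[OF A] e] by blast
    have "prob (A - K) \<le> prob (U - K)"
      using KU by (intro finite_measure_mono) (auto simp: sets_M)
    then show ?thesis using KU by (intro exI[of _ K]) auto
  qed
  then have "\<exists>K. \<forall>A\<in>\<xi>. closed (K A) \<and> K A \<subseteq> A \<and> prob (A - K A) \<le> ?e" by (intro bchoice ballI)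
  then obtain K where K': "\<forall>A\<in>\<xi>. closed (K A) \<and> K A \<subseteq> A \<and> prob (A - K A) \<le> ?e" by (elim exE)
  have K: "closed (K A)" "K A \<subseteq> A" "prob (A - K A) \<le> ?e" if "A \<in> \<xi>" for A
    using bspec[OF K' that] by simp_all
  have K_sets: "A - K A \<in> sets M" if "A \<in> \<xi>" for A
    using \<xi>(1)[OF that] K(1)[OF that] by (auto simp: sets_M)
  have "- (\<Union>A\<in>\<xi>. K A) \<subseteq> (\<Union>A\<in>\<xi>. A - K A)"
  proof
    fix x assume x: "x \<in> - (\<Union>A\<in>\<xi>. K A)"
    obtain A where "A \<in> \<xi>" "x \<in> A" using \<xi>(2) by blast
    then show "x \<in> (\<Union>A\<in>\<xi>. A - K A)" using x by blast
  qed
  then have "prob (- (\<Union>A\<in>\<xi>. K A)) \<le> prob (\<Union>A\<in>\<xi>. A - K A)"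
    using K_sets finite_symbols by (intro finite_measure_mono sets.finite_UN) auto
  also have "\<dots> \<le> (\<Sum>A\<in>\<xi>. prob (A - K A))"
    using K_sets finite_symbols by (intro measure_UNION_le) auto
  also have "\<dots> \<le> (\<Sum>A\<in>\<xi>. ?e)" using K by (intro sum_mono)
  also have "\<dots> \<le> e" using assms by (simp add: field_simps)
  finally have K0: "prob (- (\<Union>A\<in>\<xi>. K A)) \<le> e" .
  have "\<exists>d>0. \<forall>x\<in>K A. \<forall>y\<in>K B. A \<noteq> B \<longrightarrow> d \<le> dist x y" if A: "A \<in> \<xi>" and B: "B \<in> \<xi>" for A B
  proof (cases "A = B")
    case True
    then show ?thesis by (intro exI[of _ 1]) auto
  next
    case False
    then have "A \<inter> B = {}" using \<xi>(3) A B by (simp add: disjoint_def)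
    then have "K A \<inter> K B = {}" using K(2)[OF A] K(2)[OF B] by blast
    moreover have "compact (K A)" using compact_Int_closed[OF compact_UNIV K(1)[OF A]] by simp
    ultimately obtain d where "d > 0" "\<forall>x\<in>K A. \<forall>y\<in>K B. d \<le> dist x y"
      using compact_closed_separation[OF _ K(1)[OF B]] by blast
    then show ?thesis by blast
  qed
  then obtain d where d: "\<And>A B. A \<in> \<xi> \<Longrightarrow> B \<in> \<xi> \<Longrightarrow> d A B > 0 \<and> (\<forall>x\<in>K A. \<forall>y\<in>K B. A \<noteq> B \<longrightarrow> d A B \<le> dist x y)"
    by metis
  \<comment> \<open>The extra element 1 keeps the set nonempty and does not affect positivity of the
    minimum.\<close>
  let ?d = "Min (insert 1 ((\<lambda>(A, B). d A B) ` (\<xi> \<times> \<xi>)))"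
  have fin: "finite (insert 1 ((\<lambda>(A, B). d A B) ` (\<xi> \<times> \<xi>)))" using finite_symbols by simp
  have "?d > 0" using d fin by (subst Min_gr_iff) auto
  moreover have "?d \<le> dist x y" if "A \<in> \<xi>" "B \<in> \<xi>" "x \<in> K A" "y \<in> K B" "A \<noteq> B" for A B x y
  proof -
    have "?d \<le> d A B" using that by (intro Min_le[OF fin]) auto
    also have "\<dots> \<le> dist x y" using d[OF that(1,2)] that by blast
    finally show ?thesis .
  qed
  ultimately show ?thesis using K K0 by (intro exI[of _ K] exI[of _ ?d]) blast
qed

text \<open>Off the visits to the complement of \<open>\<Union>A. K A\<close>, a matched symbol of \<open>y\<close> is the unique \<open>A\<close> with \<open>K A\<close>
  within \<open>\<epsilon>\<close> of the orbit point of \<open>x\<close>; the \<open>SOME\<close> is arbitrary at the other indices.\<close>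

lemma fk_ball_matched:
  assumes K: "\<And>A. A \<in> \<xi> \<Longrightarrow> K A \<subseteq> A"
    and sep: "\<And>A B x y. A \<in> \<xi> \<Longrightarrow> B \<in> \<xi> \<Longrightarrow> x \<in> K A \<Longrightarrow> y \<in> K B \<Longrightarrow> A \<noteq> B \<Longrightarrow> d \<le> dist x y"
    and n: "n > 0" and \<epsilon>: "2 * \<epsilon> \<le> d" and y: "y \<in> fk_ball T q n x \<epsilon>"
    and visits: "real (card {i \<in> {..<n}. (T ^^ (q * i)) y \<in> - (\<Union>A\<in>\<xi>. K A)}) < \<kappa> * real n"
    and B: "\<And>u. \<bar>\<phi> u\<bar> \<le> B" and \<eta>: "0 \<le> \<eta>" and unif: "\<And>u v. dist u v < \<epsilon> \<Longrightarrow> \<bar>\<phi> u - \<phi> v\<bar> \<le> \<eta>"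
  shows "(\<lambda>i\<in>{..<n}. cell ((T ^^ (q * i)) y)) \<in> matched_words n (nat \<lfloor>(\<epsilon> + \<kappa>) * real n\<rfloor>) \<xi>
      (\<lambda>i. SOME A. A \<in> \<xi> \<and> (\<exists>z\<in>K A. dist ((T ^^ (q * i)) x) z < \<epsilon>))"
    and "birkhoff_sum T q n \<phi> y \<le> birkhoff_sum T q n \<phi> x + real n * (\<eta> + 2 * B * \<epsilon>)"
proof -
  obtain \<delta> where \<delta>: "0 < \<delta>" "\<delta> < \<epsilon>" "fk_gap T q n \<delta> x y < \<delta>" using y by (auto simp: fk_ball_iff)
  then obtain \<pi> D R where match: "fk_match T q n \<delta> x y \<pi> D R" and cD: "real n * (1 - \<delta>) < real (card D)"
    using fk_gap_less_iff[OF n] by blast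
  have D: "D \<subseteq> {..<n}" "\<pi> ` D \<subseteq> {..<n}" "inj_on \<pi> D" "strict_mono_on D \<pi>"
    and dist: "\<And>i. i \<in> D \<Longrightarrow> dist ((T ^^ (q * i)) x) ((T ^^ (q * \<pi> i)) y) < \<epsilon>"
    using match \<delta> by (auto simp: fk_match_def bij_betw_def intro: less_trans)
  have "real n * (1 - \<epsilon>) \<le> real n * (1 - \<delta>)" using \<delta> by (intro mult_left_mono) auto
  then have cD': "real n - real n * \<epsilon> < real (card D)" using cD by (simp add: algebra_simps)
  have B0: "0 \<le> B" using B[of undefined] by linarith
  show "birkhoff_sum T q n \<phi> y \<le> birkhoff_sum T q n \<phi> x + real n * (\<eta> + 2 * B * \<epsilon>)"
  proof -
    have "birkhoff_sum T q n \<phi> y \<le> birkhoff_sum T q n \<phi> x + real n * \<eta> + 2 * B * (real n - real (card D))"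
      using \<delta> by (intro birkhoff_sum_match[OF match B \<eta>] unif) auto
    also have "2 * B * (real n - real (card D)) \<le> 2 * B * (real n * \<epsilon>)"
      using cD' B0 by (intro mult_left_mono) auto
    finally show ?thesis by (simp add: algebra_simps)
  qed
  let ?K0 = "- (\<Union>A\<in>\<xi>. K A)"
  let ?V = "{i \<in> {..<n}. (T ^^ (q * i)) y \<in> ?K0}"
  let ?D = "{i \<in> D. (T ^^ (q * \<pi> i)) y \<notin> ?K0}"
  let ?a = "\<lambda>i. SOME A. A \<in> \<xi> \<and> (\<exists>z\<in>K A. dist ((T ^^ (q * i)) x) z < \<epsilon>)"
  have finD: "finite D" using D(1) finite_subset by blast
  \<comment> \<open>\<open>\<pi>\<close> maps the dropped indices injectively to visits of
    \<open>y\<close>. So at most \<open>\<epsilon> * n\<close> indices are lost by the match and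
    \<open>\<kappa> * n\<close> by visits.\<close>
  have "card (D - ?D) \<le> card ?V"
    using D by (intro card_inj_on_le[of \<pi>]) (auto intro: inj_on_subset)
  moreover have "card D = card ?D + card (D - ?D)"
    using finD card_mono[OF finD, of ?D] by (subst card_Diff_subset) auto
  ultimately have "real (card D) - real (card ?V) \<le> real (card ?D)" by linarith
  then have "real n - real (card ?D) \<le> (\<epsilon> + \<kappa>) * real n"
    using cD' visits by (simp add: algebra_simps)
  then have "int n - int (card ?D) \<le> \<lfloor>(\<epsilon> + \<kappa>) * real n\<rfloor>" by (simp add: le_floor_iff)
  then have slack: "n \<le> card ?D + nat \<lfloor>(\<epsilon> + \<kappa>) * real n\<rfloor>" by linarith
  have sym: "(\<lambda>i\<in>{..<n}. cell ((T ^^ (q * i)) y)) (\<pi> i) = ?a i" if i: "i \<in> ?D" for i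
  proof -
    obtain A where A: "A \<in> \<xi>" "(T ^^ (q * \<pi> i)) y \<in> K A" using i by auto
    have lt: "dist ((T ^^ (q * i)) x) ((T ^^ (q * \<pi> i)) y) < \<epsilon>" using dist i by auto
    have "?a i = A"
    proof (rule some_equality)
      show "A \<in> \<xi> \<and> (\<exists>z\<in>K A. dist ((T ^^ (q * i)) x) z < \<epsilon>)" using A lt by blast
      fix A' assume "A' \<in> \<xi> \<and> (\<exists>z\<in>K A'. dist ((T ^^ (q * i)) x) z < \<epsilon>)"
      then obtain z where z: "A' \<in> \<xi>" "z \<in> K A'" "dist ((T ^^ (q * i)) x) z < \<epsilon>" by blast
      \<comment> \<open>Both points are within \<open>\<epsilon>\<close> of the same orbit point of
        \<open>x\<close>, and \<open>2 * \<epsilon> \<le> d\<close>, so they cannot come from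
        different cells.\<close>
      have "dist z ((T ^^ (q * \<pi> i)) y) < d"
        using dist_triangle3[of z "(T ^^ (q * \<pi> i)) y" "(T ^^ (q * i)) x"] z(3) lt \<epsilon> by linarith
      then show "A' = A" using sep[OF z(1) A(1) z(2) A(2)] by linarith
    qed
    moreover have "cell ((T ^^ (q * \<pi> i)) y) = A" using A K[OF A(1)] by (intro cell_eq) auto
    moreover have "\<pi> i < n" using D(2) i by auto
    ultimately show ?thesis by simp
  qed
  have "(\<lambda>i\<in>{..<n}. cell ((T ^^ (q * i)) y)) \<in> PiE {..<n} (\<lambda>_. \<xi>)" using cell_in by auto
  moreover have "?D \<subseteq> {..<n}" "\<pi> ` ?D \<subseteq> {..<n}" using D by auto
  moreover have "strict_mono_on ?D \<pi>" using D(4) by (auto simp: strict_mono_on_def)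
  ultimately show "(\<lambda>i\<in>{..<n}. cell ((T ^^ (q * i)) y)) \<in> matched_words n (nat \<lfloor>(\<epsilon> + \<kappa>) * real n\<rfloor>) \<xi> ?a"
    using slack sym unfolding matched_words_def by blast
qed

text \<open>By invariance the expected frequency of visits is at most
  \<open>\<kappa>\<^sup>2\<close>, so Markov's inequality bounds the probability of a frequency of
  at least \<open>\<kappa>\<close> by \<open>\<kappa>\<close>. Nothing depends on
  \<open>q\<close>.\<close>

lemma few_visits:
  fixes q :: nat
  assumes K0: "K0 \<in> sets M" "prob K0 \<le> \<kappa>\<^sup>2" and \<kappa>: "\<kappa> > 0" and n: "n > 0"
  defines "V \<equiv> {y. real (card {i \<in> {..<n}. (T ^^ (q * i)) y \<in> K0}) < \<kappa> * real n}"
  shows "V \<in> sets M" "prob V \<ge> 1 - \<kappa>"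
proof -
  define u where "u y = (\<Sum>i<n. indicator K0 ((T ^^ (q * i)) y) :: real)" for y
  have u_card: "u y = real (card {i \<in> {..<n}. (T ^^ (q * i)) y \<in> K0})" for y
    unfolding u_def by (simp add: indicator_def of_bool_def sum.If_cases Int_def)
  note [measurable] = K0(1)
  have [measurable]: "u \<in> borel_measurable M" unfolding u_def by measurable
  have int1: "integrable M (indicator K0 :: 'a \<Rightarrow> real)" using K0 by (simp add: less_top[symmetric])
  have int: "integrable M (\<lambda>y. indicator K0 ((T ^^ (q * i)) y) :: real)" for i
    by (rule integrable_funpow[OF int1])
  have "(\<integral>y. u y \<partial>M) = (\<Sum>i<n. \<integral>y. indicator K0 ((T ^^ (q * i)) y) \<partial>M)"
    unfolding u_def using int by (intro Bochner_Integration.integral_sum) auto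
  also have "\<dots> = real n * prob K0"
    by (subst integral_funpow) (simp_all add: Int_absorb2)
  also have "\<dots> \<le> real n * \<kappa>\<^sup>2" using K0 by (intro mult_left_mono) auto
  finally have int_u: "(\<integral>y. u y \<partial>M) \<le> real n * \<kappa>\<^sup>2" .
  have "prob {y \<in> space M. u y \<ge> \<kappa> * real n} \<le> (\<integral>y. u y \<partial>M) / (\<kappa> * real n)"
  proof (rule integral_Markov_inequality_measure[of M u "{}"])
    show "integrable M u" unfolding u_def using int by (intro Bochner_Integration.integrable_sum)
  qed (use \<kappa> n in \<open>auto simp: u_def intro!: sum_nonneg\<close>)
  also have "\<dots> \<le> \<kappa>" using int_u \<kappa> n by (simp add: divide_le_eq power2_eq_square mult_ac)
  finally have le: "prob {y \<in> space M. u y \<ge> \<kappa> * real n} \<le> \<kappa>" .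
  have V: "V = space M - {y \<in> space M. u y \<ge> \<kappa> * real n}"
    unfolding V_def u_card[symmetric] by auto
  have Z: "{y \<in> space M. u y \<ge> \<kappa> * real n} \<in> sets M" by measurable
  show "V \<in> sets M" unfolding V using Z by (rule sets.compl_sets)
  show "prob V \<ge> 1 - \<kappa>" unfolding V prob_compl[OF Z] using le by simp
qed

text \<open>In the error, \<open>2 * \<eta>\<close> and \<open>4 * ln (1 / \<eta>)\<close> come from
  the squared binomial sum with up to \<open>2 * \<kappa> * n\<close> unmatched indices, the third
  \<open>\<eta>\<close> from the oscillation of \<open>\<phi>\<close>. The term
  \<open>4 * ln (real (card \<xi>))\<close> is half unmatched letters, half discarded points;
  \<open>6 * B\<close> is \<open>2 * B\<close> for unmatched times and \<open>4 * B\<close> for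
  discarded points.\<close>

lemma fk_cover_lower_bound:
  fixes k :: nat
  assumes K: "\<And>A. A \<in> \<xi> \<Longrightarrow> closed (K A)" "\<And>A. A \<in> \<xi> \<Longrightarrow> K A \<subseteq> A"
    and K0: "prob (- (\<Union>A\<in>\<xi>. K A)) \<le> \<kappa>\<^sup>2"
    and sep: "\<And>A B x y. A \<in> \<xi> \<Longrightarrow> B \<in> \<xi> \<Longrightarrow> x \<in> K A \<Longrightarrow> y \<in> K B \<Longrightarrow> A \<noteq> B \<Longrightarrow> d \<le> dist x y"
    and n: "n > 0" and q: "q \<ge> 1" and \<epsilon>: "0 < \<epsilon>" "\<epsilon> \<le> \<kappa>" "2 * \<epsilon> \<le> d"
    and \<phi>: "continuous_on UNIV \<phi>" and B: "\<And>u. \<bar>\<phi> u\<bar> \<le> B"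
    and \<eta>: "0 < \<eta>" "\<eta> \<le> 1" and unif: "\<And>u v. dist u v < \<epsilon> \<Longrightarrow> \<bar>\<phi> u - \<phi> v\<bar> \<le> \<eta>"
    and k: "k \<ge> 1" and cover: "prob (\<Union>i\<in>{1..k}. fk_ball T q n (x i) \<epsilon>) > 1 - \<epsilon>"
  shows "real n * (entropy_rate + integral\<^sup>L M \<phi>) \<le> ln (\<Sum>i=1..k. exp (birkhoff_sum T q n \<phi> (x i)))
    + ln 2 + real n * (3 * \<eta> + \<kappa> * (4 * ln (1 / \<eta>) + 4 * ln (real (card \<xi>)) + 6 * B))"
proof -
  let ?F = "\<lambda>i x. cell ((T ^^ (q * i)) x)"
  let ?\<psi> = "birkhoff_sum T q n \<phi>"
  let ?K0 = "- (\<Union>A\<in>\<xi>. K A)"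
  let ?V = "{y. real (card {i \<in> {..<n}. (T ^^ (q * i)) y \<in> ?K0}) < \<kappa> * real n}"
  let ?U = "\<Union>i\<in>{1..k}. fk_ball T q n (x i) \<epsilon>"
  let ?m = "nat \<lfloor>(\<epsilon> + \<kappa>) * real n\<rfloor>"
  let ?N = "\<lambda>j. matched_words n ?m \<xi> (\<lambda>i. SOME A. A \<in> \<xi> \<and> (\<exists>z\<in>K A. dist ((T ^^ (q * i)) (x j)) z < \<epsilon>))"
  let ?l = "ln (1 / \<eta>)" and ?s = "ln (real (card \<xi>))"
  let ?L = "exp (2 * (real n * \<eta> + real ?m * ?l) + real ?m * ?s)"
  interpret Q: finite_coding M ?F \<xi>
    by unfold_locales (use finite_symbols coding_measurable in auto)
  have \<kappa>: "\<kappa> > 0" using \<epsilon> by simp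
  have B0: "0 \<le> B" using B[of undefined] by linarith
  have \<xi>_ne: "\<xi> \<noteq> {}" using cell_in[of undefined] by auto
  then have c\<xi>: "card \<xi> \<ge> 1" using finite_symbols by (simp add: Suc_le_eq card_gt_0_iff)
  have l: "?l \<ge> 0" and s: "?s \<ge> 0" using \<eta> c\<xi> by auto
  have "(\<Union>A\<in>\<xi>. K A) \<in> sets M" using K finite_symbols by (intro sets.finite_UN) (auto simp: sets_M)
  then have "space M - (\<Union>A\<in>\<xi>. K A) \<in> sets M" by (rule sets.compl_sets)
  then have K0_sets: "?K0 \<in> sets M" by (simp add: Compl_eq_Diff_UNIV)
  note V = few_visits[OF K0_sets K0 \<kappa> n, of q]
  have U_sets: "?U \<in> sets M" using n by (intro sets.finite_UN) auto
  have G: "1 - (\<epsilon> + \<kappa>) \<le> prob (?U \<inter> ?V)"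
  proof -
    have "prob (?U \<union> ?V) = prob ?U + prob ?V - prob (?U \<inter> ?V)"
      using U_sets V(1) by (simp add: finite_measure_Union') (simp add: finite_measure_Diff' Int_commute)
    then show ?thesis using prob_le_1[of "?U \<union> ?V"] cover V(2) by linarith
  qed
  have \<psi>_bd: "\<bar>?\<psi> y\<bar> \<le> real n * B" for y
    unfolding birkhoff_sum_def using B
    by (intro order_trans[OF sum_abs] order_trans[OF sum_bounded_above[of _ _ B]]) auto
  have [measurable]: "\<phi> \<in> borel_measurable M" using \<phi> by (rule continuous_measurable)
  have \<psi>_meas: "?\<psi> \<in> borel_measurable M" unfolding birkhoff_sum_def by measurable
  have "integrable M \<phi>" using B by (intro integrable_const_bound[of _ B]) auto
  then have "(\<integral>y. ?\<psi> y \<partial>M) = (\<Sum>i<n. \<integral>y. \<phi> ((T ^^ (q * i)) y) \<partial>M)"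
    unfolding birkhoff_sum_def using integrable_funpow by (intro Bochner_Integration.integral_sum) auto
  also have "\<dots> = real n * integral\<^sup>L M \<phi>" by (simp add: integral_funpow)
  finally have \<psi>_int: "(\<integral>y. ?\<psi> y \<partial>M) = real n * integral\<^sup>L M \<phi>" .
  have m: "real ?m \<le> 2 * \<kappa> * real n"
  proof -
    have "real ?m \<le> (\<epsilon> + \<kappa>) * real n" using \<epsilon> by (intro of_nat_floor) auto
    also have "\<dots> \<le> (2 * \<kappa>) * real n" using \<epsilon> by (intro mult_right_mono) auto
    finally show ?thesis .
  qed
  have L: "real (card (?N j)) \<le> ?L" for j
  proof -
    have "real (card (?N j)) \<le> (real (\<Sum>j\<le>?m. n choose j))\<^sup>2 * real (card \<xi>) ^ ?m"
      using of_nat_mono[OF card_matched_words[OF finite_symbols \<xi>_ne], where 'a = real] by simp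
    also have "\<dots> \<le> (exp (real n * \<eta> + real ?m * ?l))\<^sup>2 * real (card \<xi>) ^ ?m"
      using \<eta> by (intro mult_right_mono power_mono sum_choose_le_exp) (auto intro: sum_nonneg)
    also have "real (card \<xi>) ^ ?m = exp (real ?m * ?s)"
      using c\<xi> by (simp add: exp_of_nat_mult)
    also have "(exp (real n * \<eta> + real ?m * ?l))\<^sup>2 = exp (2 * (real n * \<eta> + real ?m * ?l))"
      by (simp only: exp_double)
    finally show ?thesis by (simp add: exp_add)
  qed
  have "cyl_entropy M ?F {..<n} + (\<integral>y. ?\<psi> y \<partial>M)
    \<le> ln (\<Sum>j=1..k. exp (?\<psi> (x j))) + ln (?L + 1) + real n * (\<eta> + 2 * B * \<epsilon>)
      + (\<epsilon> + \<kappa>) * (2 * (real n * B) + real (card {..<n}) * ?s)"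
  proof (rule Q.entropy_cover_bound[where N = ?N and G = "?U \<inter> ?V"])
    show "finite {..<n}" "\<xi> \<noteq> {}" "finite {1..k}" "{1..k} \<noteq> {}" using \<xi>_ne k by auto
    show "?N j \<subseteq> PiE {..<n} (\<lambda>_. \<xi>)" for j by (auto simp: matched_words_def)
    show "real (card (?N j)) \<le> ?L" for j by (rule L)
    show "- (real n * B) \<le> ?\<psi> (x j)" for j using \<psi>_bd[of "x j"] by linarith
    show "?U \<inter> ?V \<in> sets M" using U_sets V(1) by (rule sets.Int)
    show "0 \<le> real n * (\<eta> + 2 * B * \<epsilon>)" using \<eta> B0 \<epsilon> by simp
    fix y assume y: "y \<in> ?U \<inter> ?V"
    then obtain j where j: "j \<in> {1..k}" "y \<in> fk_ball T q n (x j) \<epsilon>" by blast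
    have visits: "real (card {i \<in> {..<n}. (T ^^ (q * i)) y \<in> ?K0}) < \<kappa> * real n" using y by blast
    have \<eta>0: "0 \<le> \<eta>" using \<eta> by simp
    have "(\<lambda>i\<in>{..<n}. ?F i y) \<in> ?N j"
      by (rule fk_ball_matched(1)[where K = K and d = d and \<phi> = \<phi> and B = B and \<eta> = \<eta>])
        (fact K(2) sep n \<epsilon>(3) j(2) visits B \<eta>0 unif)+
    moreover have "?\<psi> y \<le> ?\<psi> (x j) + real n * (\<eta> + 2 * B * \<epsilon>)"
      by (rule fk_ball_matched(2)[where K = K and d = d and \<phi> = \<phi> and B = B and \<eta> = \<eta>])
        (fact K(2) sep n \<epsilon>(3) j(2) visits B \<eta>0 unif)+
    ultimately show "\<exists>j\<in>{1..k}. (\<lambda>i\<in>{..<n}. ?F i y) \<in> ?N j \<and> ?\<psi> y \<le> ?\<psi> (x j) + real n * (\<eta> + 2 * B * \<epsilon>)"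
      using j(1) by blast
  qed (fact \<psi>_meas \<psi>_bd G)+
  moreover have "real n * entropy_rate \<le> cyl_entropy M ?F {..<n}"
    using entropy_rate_arithmetic_progression[OF q, of n] cyl_entropy_reindex[of M itinerary "(*) q" "{..<n}"]
    by simp
  moreover have "ln (?L + 1) \<le> ln 2 + real n * (2 * \<eta> + \<kappa> * (4 * ?l + 2 * ?s))"
  proof -
    have "?L \<ge> 1" using \<eta> l s by simp
    then have "ln (?L + 1) \<le> ln (2 * ?L)" by (intro ln_mono add_pos_pos exp_gt_zero) auto
    also have "\<dots> = ln 2 + (2 * (real n * \<eta> + real ?m * ?l) + real ?m * ?s)" by (simp add: ln_mult)
    also have "\<dots> = ln 2 + 2 * real n * \<eta> + real ?m * (2 * ?l + ?s)" by (simp add: algebra_simps)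
    also have "real ?m * (2 * ?l + ?s) \<le> (2 * \<kappa> * real n) * (2 * ?l + ?s)"
      using m l s by (intro mult_right_mono) auto
    finally show ?thesis by (simp add: algebra_simps)
  qed
  moreover have "real n * (\<eta> + 2 * B * \<epsilon>) \<le> real n * (\<eta> + 2 * B * \<kappa>)"
    using \<epsilon> B0 by (intro mult_left_mono add_left_mono) auto
  moreover have "(\<epsilon> + \<kappa>) * (2 * (real n * B) + real (card {..<n}) * ?s) \<le> (2 * \<kappa>) * (2 * (real n * B) + real n * ?s)"
    unfolding card_lessThan using \<epsilon> B0 s by (intro mult_right_mono) auto
  ultimately have "real n * entropy_rate + real n * integral\<^sup>L M \<phi> \<le> ln (\<Sum>j=1..k. exp (?\<psi> (x j)))
    + (ln 2 + real n * (2 * \<eta> + \<kappa> * (4 * ?l + 2 * ?s))) + real n * (\<eta> + 2 * B * \<kappa>)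
    + (2 * \<kappa>) * (2 * (real n * B) + real n * ?s)"
    unfolding \<psi>_int by linarith
  then show ?thesis by (simp add: algebra_simps)
qed

end

context compact_ergodic_system
begin

text \<open>A real \<open>a\<close> below the target allows for infinite entropy. Some partition
  already has rate plus integral above \<open>a\<close>, and the gap \<open>g\<close> pays for all
  errors, in the order \<open>\<eta>\<close>, \<open>\<kappa>\<close>, \<open>d\<close>,
  \<open>\<epsilon>\<close>.\<close>

lemma eventually_liminf_fk_ge:
  assumes \<phi>: "continuous_on UNIV \<phi>" and a: "ereal a < ks_entropy M T + ereal (integral\<^sup>L M \<phi>)"
  shows "eventually (\<lambda>\<epsilon>. ereal a \<le> liminf (\<lambda>n. ereal (ln (fk_cover_sum_inf T n \<phi> M \<epsilon>) / real n))) (at_right 0)"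
proof -
  obtain B where B: "\<And>x. \<bar>\<phi> x\<bar> \<le> B" using continuous_bounded[OF \<phi>] by blast
  have B0: "0 \<le> B" using B[of undefined] by linarith
  have "ereal (a - integral\<^sup>L M \<phi>) < ks_entropy M T" using a by (cases "ks_entropy M T") auto
  then obtain \<xi> where \<xi>: "\<xi> \<in> finite_partitions M"
    "ereal (a - integral\<^sup>L M \<phi>) < entropy_wrt_partition M T \<xi>"
    unfolding ks_entropy_def less_SUP_iff by blast
  interpret compact_partition M T \<xi> by unfold_locales fact
  define g where "g = entropy_rate + integral\<^sup>L M \<phi> - a"
  have g: "g > 0" using \<xi>(2) by (simp add: entropy_wrt_partition_eq g_def)
  \<comment> \<open>Five shares: three are the explicit \<open>3 * \<eta>\<close> of the bound, one
    covers \<open>\<kappa> * v\<close>, and one covers \<open>ln 2 / n\<close> for large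
    \<open>n\<close>.\<close>
  define \<eta> where "\<eta> = min 1 (g / 5)"
  have \<eta>: "0 < \<eta>" "\<eta> \<le> 1" "5 * \<eta> \<le> g" using g by (auto simp: \<eta>_def)
  define v where "v = 4 * ln (1 / \<eta>) + 4 * ln (real (card \<xi>)) + 6 * B"
  have "\<xi> \<noteq> {}" using cell_in[of undefined] by auto
  then have "card \<xi> \<ge> 1" using finite_symbols by (simp add: Suc_le_eq card_gt_0_iff)
  then have v: "v \<ge> 0" unfolding v_def using \<eta> B0 by (intro add_nonneg_nonneg) auto
  \<comment> \<open>\<open>v\<close> may be 0, hence the denominator \<open>v + 1\<close>.\<close>
  define \<kappa> where "\<kappa> = \<eta> / (v + 1)"
  have \<kappa>: "0 < \<kappa>" "\<kappa> * v \<le> \<eta>" using \<eta> v by (auto simp: \<kappa>_def field_simps)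
  obtain K d where d: "d > 0" and K': "\<forall>A\<in>\<xi>. closed (K A) \<and> K A \<subseteq> A"
    and K0: "prob (- (\<Union>A\<in>\<xi>. K A)) \<le> \<kappa>\<^sup>2"
    and sep: "\<forall>A\<in>\<xi>. \<forall>B\<in>\<xi>. \<forall>x\<in>K A. \<forall>y\<in>K B. A \<noteq> B \<longrightarrow> d \<le> dist x y"
    using partition_closed_approx[OF zero_less_power[OF \<kappa>(1)], of 2] by (elim exE conjE)
  note K = K'[rule_format, THEN conjunct1] K'[rule_format, THEN conjunct2]
  have "uniformly_continuous_on UNIV \<phi>" using compact_uniformly_continuous[OF \<phi> compact_UNIV] .
  then obtain d' where d': "d' > 0" "\<And>u v. dist u v < d' \<Longrightarrow> \<bar>\<phi> u - \<phi> v\<bar> < \<eta>"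
    unfolding uniformly_continuous_on_def using \<eta>(1) by (auto simp: dist_real_def)
  \<comment> \<open>The four bounds make covers available, absorb \<open>\<epsilon>\<close> into
    \<open>\<kappa>\<close>, separate the cells, and give the modulus of continuity of
    \<open>\<phi>\<close>.\<close>
  define \<epsilon>0 where "\<epsilon>0 = min 1 (min \<kappa> (min (d / 2) d'))"
  have "ereal a \<le> liminf (\<lambda>n. ereal (ln (fk_cover_sum_inf T n \<phi> M \<epsilon>) / real n))"
    if \<epsilon>: "0 < \<epsilon>" "\<epsilon> < \<epsilon>0" for \<epsilon>
  proof (rule Liminf_bounded)
    obtain N where N: "ln 2 / \<eta> < real N" using reals_Archimedean2 by blast
    have "ereal a \<le> ereal (ln (fk_cover_sum_inf T n \<phi> M \<epsilon>) / real n)" if n: "n \<ge> max 1 N" for n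
    proof -
      have n0: "n > 0" using n by simp
      have "ln 2 / \<eta> < real n" using N n by linarith
      then have ln2: "ln 2 \<le> real n * \<eta>" using \<eta> by (simp add: pos_divide_less_eq less_imp_le)
      have "exp (real n * a) \<le> fk_cover_sum_inf T n \<phi> M \<epsilon>"
      proof (rule fk_cover_sum_inf_ge[OF \<phi> n0 \<epsilon>(1)])
        show "\<epsilon> \<le> 1" using \<epsilon> by (simp add: \<epsilon>0_def)
        fix q k :: nat and x
        assume q: "q \<ge> 1" and k: "k \<ge> 1" and cover: "prob (\<Union>i\<in>{1..k}. fk_ball T q n (x i) \<epsilon>) > 1 - \<epsilon>"
        let ?\<Sigma> = "\<Sum>i=1..k. exp (birkhoff_sum T q n \<phi> (x i))"
        have "real n * (entropy_rate + integral\<^sup>L M \<phi>) \<le> ln ?\<Sigma> + ln 2 + real n * (3 * \<eta> + \<kappa> * v)"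
          unfolding v_def
        proof (rule fk_cover_lower_bound[OF K K0 sep[rule_format] n0 q \<epsilon>(1) _ _ \<phi> B \<eta>(1,2) _ k cover])
          show "\<epsilon> \<le> \<kappa>" "2 * \<epsilon> \<le> d" using \<epsilon> by (auto simp: \<epsilon>0_def)
          show "\<bar>\<phi> u - \<phi> v\<bar> \<le> \<eta>" if "dist u v < \<epsilon>" for u v
            using d'(2)[of u v] that \<epsilon> by (auto simp: \<epsilon>0_def)
        qed
        moreover have "real n * (3 * \<eta> + \<kappa> * v) \<le> real n * (4 * \<eta>)"
          using \<kappa> by (intro mult_left_mono) auto
        moreover have "real n * (5 * \<eta>) \<le> real n * g" using \<eta> by (intro mult_left_mono) auto
        ultimately have "real n * a \<le> ln ?\<Sigma>"
          using ln2 by (simp add: g_def algebra_simps)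
        moreover have "?\<Sigma> > 0" using k by (intro sum_pos) auto
        ultimately show "exp (real n * a) \<le> ?\<Sigma>" by (simp add: ln_ge_iff)
      qed
      then have "real n * a \<le> ln (fk_cover_sum_inf T n \<phi> M \<epsilon>)"
        by (subst ln_ge_iff) (auto intro: less_le_trans[OF exp_gt_zero])
      then show ?thesis using n0 by (simp add: pos_le_divide_eq mult.commute)
    qed
    then show "eventually (\<lambda>n. ereal a \<le> ereal (ln (fk_cover_sum_inf T n \<phi> M \<epsilon>) / real n)) sequentially"
      unfolding eventually_sequentially by blast
  qed
  moreover have "\<epsilon>0 > 0" using \<kappa> d d' by (simp add: \<epsilon>0_def)
  ultimately show ?thesis unfolding eventually_at_right_field by blast
qed

end

lemma compact_ergodic_systemI:
  assumes "top_dyn_system T" "\<mu> \<in> ergodic_measures T"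
  shows "compact_ergodic_system \<mu> T"
proof -
  have cont: "continuous_on UNIV T" and comp: "compact (UNIV :: 'a::metric_space set)"
    using assms(1) by (auto simp: top_dyn_system_def homeomorphism_def)
  have \<mu>: "prob_space \<mu>" "sets \<mu> = sets borel" "distr \<mu> \<mu> T = \<mu>"
    and erg: "\<forall>A\<in>sets \<mu>. T -` A \<inter> space \<mu> = A \<longrightarrow> measure \<mu> A = 0 \<or> measure \<mu> A = 1"
    using assms(2) by (auto simp: ergodic_measures_def)
  interpret prob_space \<mu> by fact
  have "T \<in> measurable \<mu> \<mu>"
    using borel_measurable_continuous_onI[OF cont] measurable_cong_sets[OF \<mu>(2) \<mu>(2)] by blast
  then interpret pmp_system \<mu> T by unfold_locales (use \<mu> in auto)
  show ?thesis using cont comp \<mu>(2) erg by unfold_locales (auto simp: ergodic_def)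
qed

theorem theorem3p4:
  fixes T :: "'a::metric_space \<Rightarrow> 'a" and \<mu> :: "'a measure" and \<phi> :: "'a \<Rightarrow> real"
  assumes "top_dyn_system T"
    and "\<mu> \<in> ergodic_measures T"
    and "continuous_on UNIV \<phi>"
  shows "((\<lambda>\<epsilon>. liminf (\<lambda>n. ereal (ln (fk_cover_sum_inf T n \<phi> \<mu> \<epsilon>) / real n)))
            \<longlongrightarrow> ks_entropy \<mu> T + ereal (integral\<^sup>L \<mu> \<phi>)) (at_right 0)
       \<and> ((\<lambda>\<epsilon>. limsup (\<lambda>n. ereal (ln (fk_cover_sum_inf T n \<phi> \<mu> \<epsilon>) / real n)))
            \<longlongrightarrow> ks_entropy \<mu> T + ereal (integral\<^sup>L \<mu> \<phi>)) (at_right 0)"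
proof -
  interpret compact_ergodic_system \<mu> T by (rule compact_ergodic_systemI) fact+
  let ?u = "\<lambda>\<epsilon> n. ereal (ln (fk_cover_sum_inf T n \<phi> \<mu> \<epsilon>) / real n)"
  let ?h = "ks_entropy \<mu> T + ereal (integral\<^sup>L \<mu> \<phi>)"
  have le: "liminf (?u \<epsilon>) \<le> limsup (?u \<epsilon>)" for \<epsilon> by (rule Liminf_le_Limsup) simp
  have "eventually (\<lambda>\<epsilon>::real. 0 < \<epsilon> \<and> \<epsilon> \<le> 1) (at_right 0)"
    unfolding eventually_at_right_field by (intro exI[of _ 1]) auto
  then have upper: "eventually (\<lambda>\<epsilon>. limsup (?u \<epsilon>) \<le> ?h) (at_right 0)"
    by eventually_elim (use limsup_fk_le[OF assms(3)] in blast)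
  \<comment> \<open>Approaching \<open>?h\<close> through all \<open>c < ?h\<close>, rather than up
    to an additive error, treats finite and infinite entropy alike.\<close>
  have lower: "eventually (\<lambda>\<epsilon>. c < liminf (?u \<epsilon>)) (at_right 0)" if c: "c < ?h" for c
  proof -
    obtain a where a: "c < ereal a" "ereal a < ?h" using ereal_dense2[OF c] by blast
    from eventually_liminf_fk_ge[OF assms(3) a(2)] show ?thesis
      by eventually_elim (use a(1) in \<open>rule less_le_trans\<close>)
  qed
  show ?thesis
  proof (intro conjI order_tendstoI)
    fix c assume "c < ?h"
    from lower[OF this] show "eventually (\<lambda>\<epsilon>. c < liminf (?u \<epsilon>)) (at_right 0)" .
    then show "eventually (\<lambda>\<epsilon>. c < limsup (?u \<epsilon>)) (at_right 0)"
      by eventually_elim (rule less_le_trans[OF _ le])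
  next
    fix c assume c: "?h < c"
    from upper show "eventually (\<lambda>\<epsilon>. limsup (?u \<epsilon>) < c) (at_right 0)"
      by eventually_elim (rule le_less_trans[OF _ c])
    then show "eventually (\<lambda>\<epsilon>. liminf (?u \<epsilon>) < c) (at_right 0)"
      by eventually_elim (rule le_less_trans[OF le])
  qed
qed

end
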